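(* For $n,k\ge1$ let $p(n,k)$ be the number of genus $2$ partitions of $\{1,\ldots,n\}$ with $k$ parts, and let $P(x,y)=\sum_{n,k}p(n,k)x^ny^k$. Then $$P(x,y)=\frac{x^6y^2\cdot p(x,y)}{(x^2-2x^2y-2x+x^2y^2-2xy+1)^{11/2}},$$ where $$\begin{aligned}p(x,y)={}&x^4(8y^4-4y^3-15y^2+10y+1)+x^3(-4y^3+39y^2-10y-4)\\&+x^2(-15y^2-10y+6)+x(10y-4)+1.\end{aligned}$$
   Context: Identities are between formal power series; the $11/2$-th power of a series with constant term $1$ is the one with constant term $1$. For $n\ge1$ let $\zeta_n=(1,2,\ldots,n)$, and let $z(\cdot)$ be the number of cycles of a permutation (fixed points included). Products of permutations are composed right to left, i.e. $(\alpha^{-1}\zeta_n)(i)=\alpha^{-1}(\zeta_n(i))$. The genus $g(\alpha)$ of a permutation $\alpha$ of $\{1,\ldots,n\}$ is the nonnegative integer defined by $n+1-2g(\alpha)=z(\alpha)+z(\alpha^{-1}\zeta_n)$. A permutation is called a partition if each of its cycles, listed beginning with its least element, is an increasing list; thus partitions correspond bijectively to set partitions of $\{1,\ldots,n\}$, the parts being the cycles. *)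

theory Defs
  imports
    "HOL-Combinatorics.Combinatorics"
    "HOL-Computational_Algebra.Formal_Power_Series"
begin

section \<open>Permutations, genus and partitions\<close>

definition zeta :: "nat \<Rightarrow> nat \<Rightarrow> nat" where
  "zeta n = cycle_of_list [1..<Suc n]"

lemma zeta_apply:
  assumes "1 \<le> i" "i \<le> n"
  shows "zeta n i = (if i = n then 1 else i + 1)"
proof -
  let ?cs = "[1..<Suc n]"
  have "map (zeta n) ?cs = rotate1 ?cs"
    using cyclic_rotation[of ?cs 1] by (simp add: zeta_def)
  then have "map (zeta n) ?cs ! (i - 1) = rotate1 ?cs ! (i - 1)"
    by simp
  then show ?thesis
    using assms by (auto simp: nth_rotate1 mod_if simp del: upt_Suc)
qed

text \<open>For a permutation of \<open>{1..n}\<close>, the cycles are represented by their underlying sets;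
  a fixed point contributes a singleton orbit.\<close>

definition cycle_sets :: "nat \<Rightarrow> (nat \<Rightarrow> nat) \<Rightarrow> nat set set" where
  "cycle_sets n \<alpha> = orbit \<alpha> ` {1..n}"

definition num_cycles :: "nat \<Rightarrow> (nat \<Rightarrow> nat) \<Rightarrow> nat" where
  "num_cycles n \<alpha> = card (cycle_sets n \<alpha>)"

text \<open>\<open>has_genus n \<alpha> g\<close> says that \<open>g\<close> is the nonnegative integer solving the defining equation
  of the genus of \<open>\<alpha>\<close>.\<close>

definition has_genus :: "nat \<Rightarrow> (nat \<Rightarrow> nat) \<Rightarrow> nat \<Rightarrow> bool" where
  "has_genus n \<alpha> g \<longleftrightarrow>
     int n + 1 - 2 * int g = int (num_cycles n \<alpha>) + int (num_cycles n (inv \<alpha> \<circ> zeta n))"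

lemma has_genus_unique: "has_genus n \<alpha> g \<Longrightarrow> has_genus n \<alpha> h \<Longrightarrow> g = h"
  by (simp add: has_genus_def)

text \<open>The library's \<open>support \<alpha> m\<close> is the list \<open>[m, \<alpha> m, \<alpha> (\<alpha> m), \<dots>]\<close> running once through
  the cycle of \<open>m\<close>.\<close>

definition is_partition :: "nat \<Rightarrow> (nat \<Rightarrow> nat) \<Rightarrow> bool" where
  "is_partition n \<alpha> \<longleftrightarrow>
     \<alpha> permutes {1..n} \<and> (\<forall>C\<in>cycle_sets n \<alpha>. sorted_wrt (<) (support \<alpha> (Min C)))"

definition num_genus2_partitions :: "nat \<Rightarrow> nat \<Rightarrow> nat" where
  "num_genus2_partitions n k =
     card {\<alpha>. is_partition n \<alpha> \<and> has_genus n \<alpha> 2 \<and> num_cycles n \<alpha> = k}"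


section \<open>Bivariate power series\<close>

text \<open>A power series in \<open>x\<close> and \<open>y\<close> is a power series in \<open>x\<close> over the ring of power series in
  \<open>y\<close>: the coefficient of \<open>x\<^sup>n y\<^sup>k\<close> in \<open>F\<close> is \<open>fps_nth (fps_nth F n) k\<close>.\<close>

type_synonym bifps = "rat fps fps"

definition X :: bifps where "X = fps_X"
definition Y :: bifps where "Y = fps_const fps_X"

definition P :: bifps where
  "P = Abs_fps (\<lambda>n. Abs_fps (\<lambda>k.
         if n \<ge> 1 \<and> k \<ge> 1 then of_nat (num_genus2_partitions n k) else 0))"

definition half_power :: "bifps \<Rightarrow> nat \<Rightarrow> bifps" where
  \<comment> \<open>\<open>F\<close> to the power \<open>m/2\<close>\<close>
  "half_power F m = (THE Q. Q ^ 2 = F ^ m \<and> fps_nth (fps_nth Q 0) 0 = 1)"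

lemma fps_sqrt_exists:
  fixes F :: "'a::comm_ring_1 fps"
  assumes s: "s * s = fps_nth F 0" and u: "u * (2 * s) = 1"
  shows "\<exists>Q. Q ^ 2 = F \<and> fps_nth Q 0 = s"
proof -
  have "\<exists>q. \<forall>n. q n = (if n = 0 then s else
          u * (fps_nth F n - (\<Sum>i\<in>{0<..<n}. q i * q (n - i))))"
  proof -
    define H where "H = (\<lambda>(q :: nat \<Rightarrow> 'a) n. if n = 0 then s else
          u * (fps_nth F n - (\<Sum>i\<in>{0<..<n}. q i * q (n - i))))"
    have "adm_wf (measure id) H"
      unfolding adm_wf_def H_def by (auto intro!: sum.cong arg_cong2[where f = "(*)"] arg_cong2[where f = "(-)"])
    then have "wfrec (measure id) H n = H (wfrec (measure id) H) n" for n
      using wfrec_fixpoint[OF wf_measure] by metis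
    then show ?thesis unfolding H_def by blast
  qed
  then obtain q where q: "\<And>n. q n = (if n = 0 then s else
          u * (fps_nth F n - (\<Sum>i\<in>{0<..<n}. q i * q (n - i))))" by blast
  have q0: "q 0 = s" using q[of 0] by simp
  have "fps_nth (Abs_fps q ^ 2) n = fps_nth F n" for n
  proof (cases "n = 0")
    case True
    then show ?thesis using s q0 by (simp add: power2_eq_square)
  next
    case False
    let ?S = "\<Sum>i\<in>{0<..<n}. q i * q (n - i)"
    have *: "{0..n} = insert 0 (insert n {0<..<n})" using False by auto
    have "fps_nth (Abs_fps q ^ 2) n = (\<Sum>i=0..n. q i * q (n - i))"
      by (simp add: power2_eq_square fps_mult_nth)
    also have "\<dots> = q 0 * q n + (q n * q 0 + ?S)"
      unfolding * using False by simp
    also have "\<dots> = (2 * s) * q n + ?S" using q0 by (simp add: algebra_simps)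
    also have "(2 * s) * q n = (u * (2 * s)) * (fps_nth F n - ?S)"
      using q[of n] False by (simp add: mult_ac)
    finally show ?thesis using u by simp
  qed
  then have "Abs_fps q ^ 2 = F" by (intro fps_ext)
  then show ?thesis using q0 by (intro exI[of _ "Abs_fps q"]) simp
qed

lemma half_power_ex1:
  fixes F :: bifps
  assumes "fps_nth (fps_nth F 0) 0 = 1"
  shows "\<exists>!Q. Q ^ 2 = F ^ m \<and> fps_nth (fps_nth Q 0) 0 = 1"
proof -
  have F00: "fps_nth (fps_nth (F ^ m) 0) 0 = 1"
    using assms by (simp add: fps_nth_power_0)
  obtain s where s: "s ^ 2 = fps_nth (F ^ m) 0" "fps_nth s 0 = 1"
    using fps_sqrt_exists[of 1 "fps_nth (F ^ m) 0" "1/2"] F00 by auto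
  have "fps_nth (2 * s) 0 = 2" using s(2) by (simp add: fps_numeral_fps_const)
  then have "inverse (2 * s) * (2 * s) = 1"
    by (intro inverse_mult_eq_1) simp
  then obtain Q where Q: "Q ^ 2 = F ^ m" "fps_nth Q 0 = s"
    using fps_sqrt_exists[of s "F ^ m"] s by (metis power2_eq_square)
  show ?thesis
  proof (rule ex1I[of _ Q])
    show "Q ^ 2 = F ^ m \<and> fps_nth (fps_nth Q 0) 0 = 1" using Q s by simp
  next
    fix R assume R: "R ^ 2 = F ^ m \<and> fps_nth (fps_nth R 0) 0 = 1"
    then have "R = Q \<or> R = - Q" using Q by (metis power2_eq_iff)
    moreover have "R \<noteq> - Q" using R Q s by auto
    ultimately show "R = Q" by blast
  qed
qed

lemma half_power:
  assumes "fps_nth (fps_nth F 0) 0 = 1"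
  shows "half_power F m ^ 2 = F ^ m" "fps_nth (fps_nth (half_power F m) 0) 0 = 1"
  using theI'[OF half_power_ex1[OF assms, of m]] unfolding half_power_def by auto

text \<open>Although the coefficient ring \<^typ>\<open>rat fps\<close> is not a field, the library's division is the
  true quotient when the denominator has constant term \<open>1\<close>.\<close>

lemma bifps_divide_mult:
  fixes F G :: bifps
  assumes "fps_nth (fps_nth G 0) 0 = 1"
  shows "F / G * G = F"
proof -
  have ne: "fps_nth G 0 \<noteq> 0" using assms by auto
  then have "subdegree G = 0" by simp
  moreover have "inverse (fps_nth G 0) * fps_nth G 0 = 1"
    using assms by (intro inverse_mult_eq_1) simp
  then have "G * inverse G = 1"
    using fps_right_inverse[of G "inverse (fps_nth G 0)"]
    by (simp add: fps_inverse_def mult.commute)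
  ultimately show ?thesis by (simp add: fps_divide_def mult.assoc mult.commute[of "inverse G"])
qed

end

theory Submission
  imports
    Defs
    "HOL-Library.Multiset"
    "HOL-Library.More_List"
begin

text \<open>
  Build a partition by inserting \<open>1, 2, 3, \<dots>\<close> in turn, each number either as a new block or at the
  end of an existing block. Let \<open>\<beta> = \<alpha>\<inverse> \<zeta>\<^sub>n\<close>. Inserting \<open>n + 1\<close> at the end of the block with
  maximum \<open>M\<close> replaces \<open>\<beta>\<close> by \<open>(M n+1) \<beta> (n n+1)\<close>: if \<open>M\<close> lies on the cycle of \<open>\<beta>\<close> through \<open>n\<close>,
  that cycle is split and the genus is unchanged; otherwise that cycle is joined with the cycle
  of \<open>M\<close> and the genus grows by one. So the genus of all further extensions depends only on the
  number \<open>b\<close> of block maxima other than \<open>n\<close> on the cycle of \<open>n\<close>, and on the multiset \<open>N\<close> of the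
  numbers of block maxima on the other cycles. The moves are
  \<open>(b, N) \<rightarrow> (b + 1, N)\<close> for a new block, \<open>(b, N) \<rightarrow> (j, N + {b - j})\<close> for \<open>0 \<le> j \<le> b\<close>, and
  \<open>(b, N) \<rightarrow> (b + c, N - {c})\<close> in \<open>c\<close> ways for each \<open>c\<close> in \<open>N\<close>.

  The generating function of the genus 2 extensions of a partition is therefore a function of
  \<open>(b, N)\<close> satisfying a linear equation. If \<open>s\<close> is the square root of the
  discriminant and \<open>q, m = (1 - x + x y \<plusminus> s) / 2\<close>, then \<open>x = (1 - q) (1 - m)\<close>, \<open>x y = q m\<close>, and the
  solution is \<open>q\<^sup>-\<^sup>b\<close> times a polynomial in \<open>b\<close>, with a further factor \<open>q\<^sup>-\<^sup>c\<close> times a polynomial in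
  \<open>c\<close> for each element \<open>c\<close> of \<open>N\<close> that is joined later. At most two elements are joined, so
  everything is explicit.
\<close>

section \<open>Binomial sums and the kernel recursion\<close>

definition binom_sum :: "(nat \<Rightarrow> 'a::comm_ring_1) \<Rightarrow> nat \<Rightarrow> 'a" where
  "binom_sum p n = (\<Sum>i\<le>n. p i * of_nat (n choose i))"

lemma binom_sum_0 [simp]: "binom_sum p 0 = p 0"
  by (simp add: binom_sum_def)

text \<open>Pascal's rule, which drives the inductions below.\<close>

lemma binom_sum_Suc:
  "binom_sum p (Suc n) = binom_sum p n + binom_sum (\<lambda>i. p (Suc i)) n"
proof -
  have "binom_sum p n = (\<Sum>i\<le>Suc n. p i * of_nat (n choose i))"
    by (simp add: binom_sum_def binomial_eq_0)
  also have "\<dots> = p 0 + (\<Sum>i\<le>n. p (Suc i) * of_nat (n choose Suc i))"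
    by (subst sum.atMost_Suc_shift) simp
  finally have "binom_sum p n = p 0 + (\<Sum>i\<le>n. p (Suc i) * of_nat (n choose Suc i))" .
  moreover have "binom_sum p (Suc n) = p 0 + (\<Sum>i\<le>n. p (Suc i) * of_nat (Suc n choose Suc i))"
    unfolding binom_sum_def by (subst sum.atMost_Suc_shift) simp
  ultimately show ?thesis
    by (simp add: binom_sum_def sum.distrib algebra_simps)
qed

lemma binom_sum_add: "binom_sum (\<lambda>i. f i + g i) n = binom_sum f n + binom_sum g n"
  by (simp add: binom_sum_def sum.distrib algebra_simps)

lemma binom_sum_cmult: "binom_sum (\<lambda>i. c * f i) n = c * binom_sum f n"
  by (simp add: binom_sum_def sum_distrib_left algebra_simps)

lemma binom_sum_diff: "binom_sum (\<lambda>i. f i - g i) n = binom_sum f n - binom_sum g n"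
  by (simp add: binom_sum_def sum_subtractf algebra_simps)

lemma binom_sum_swap:
  "binom_sum (\<lambda>i. binom_sum (\<lambda>l. f i l) b) c = binom_sum (\<lambda>l. binom_sum (\<lambda>i. f i l) c) b"
proof -
  have "binom_sum (\<lambda>i. binom_sum (\<lambda>l. f i l) b) c
      = (\<Sum>i\<le>c. \<Sum>l\<le>b. f i l * of_nat (b choose l) * of_nat (c choose i))"
    by (simp add: binom_sum_def sum_distrib_right)
  also have "\<dots> = (\<Sum>l\<le>b. \<Sum>i\<le>c. f i l * of_nat (b choose l) * of_nat (c choose i))"
    by (rule sum.swap)
  finally show ?thesis
    by (simp add: binom_sum_def sum_distrib_right mult.assoc mult.commute[of "of_nat (b choose _)"])
qed

text \<open>Vandermonde's convolution. It separates the variables after a join, which turns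
  \<open>b\<close> into \<open>b + c\<close>.\<close>

lemma binom_sum_plus_arg:
  "binom_sum p (b + c) = binom_sum (\<lambda>l. binom_sum (\<lambda>i. p (i + l)) c) b"
  by (induction b arbitrary: p) (simp_all add: binom_sum_Suc)

text \<open>Rests on n C(n,i) = i C(n,i) + (i+1) C(n,i+1). At \<open>i = 0\<close> the truncated
  \<open>i - 1\<close> is harmless because of the factor \<open>of_nat i\<close>.\<close>

lemma of_nat_mult_binom_sum:
  "of_nat n * binom_sum p n = binom_sum (\<lambda>i. of_nat i * (p i + p (i - 1))) n"
proof (induction n arbitrary: p)
  case (Suc n)
  have "of_nat (Suc n) * binom_sum p (Suc n)
      = of_nat n * binom_sum p n + of_nat n * binom_sum (\<lambda>i. p (Suc i)) n
        + (binom_sum p n + binom_sum (\<lambda>i. p (Suc i)) n)"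
    by (simp add: binom_sum_Suc algebra_simps)
  also have "\<dots> = binom_sum (\<lambda>i. of_nat i * (p i + p (i - 1))) n
      + binom_sum (\<lambda>i. of_nat i * (p (Suc i) + p (Suc (i - 1))) + (p i + p (Suc i))) n"
    by (simp only: Suc binom_sum_add add.assoc)
  also have "(\<lambda>i. of_nat i * (p (Suc i) + p (Suc (i - 1))) + (p i + p (Suc i)))
      = (\<lambda>i. of_nat (Suc i) * (p (Suc i) + p i))"
    by (rule ext, case_tac i) (simp_all add: algebra_simps)
  finally show ?case by (simp add: binom_sum_Suc)
qed simp

section \<open>Sums over the splits of a cycle\<close>

definition diag_conv :: "(nat \<Rightarrow> nat \<Rightarrow> 'a::comm_ring_1) \<Rightarrow> nat \<Rightarrow> 'a" where
  "diag_conv f n = (\<Sum>i\<le>n. f i (n - i)) + (\<Sum>i<n. f i (n - 1 - i))"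

lemma diag_conv_Suc:
  "diag_conv f (Suc n) = f 0 (Suc n) + f 0 n + diag_conv (\<lambda>i. f (Suc i)) n"
proof -
  have "(\<Sum>i\<le>Suc n. f i (Suc n - i)) = f 0 (Suc n) + (\<Sum>i\<le>n. f (Suc i) (n - i))"
    by (subst sum.atMost_Suc_shift) simp
  moreover have "(\<Sum>i<Suc n. f i (n - i)) = f 0 n + (\<Sum>i<n. f (Suc i) (n - 1 - i))"
    by (subst sum.lessThan_Suc_shift) simp
  ultimately show ?thesis by (simp add: diag_conv_def del: sum.atMost_Suc sum.lessThan_Suc)
qed

text \<open>The sum over j of C(b-j,i) C(j,l) is C(b+1,i+l+1) = C(b,i+l+1) + C(b,i+l), whence the
  two sums in \<open>diag_conv\<close>. Such sums arise when a cycle is split into parts of sizes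
  \<open>j\<close> and \<open>b - j\<close>.\<close>

lemma sum_binom_sum_diag:
  "(\<Sum>j\<le>b. binom_sum (\<lambda>i. binom_sum (\<lambda>l. f i l) j) (b - j)) = binom_sum (diag_conv f) b"
proof (induction b arbitrary: f)
  case 0
  then show ?case by (simp add: diag_conv_def)
next
  case (Suc b)
  let ?T = "\<lambda>f b j. binom_sum (\<lambda>i. binom_sum (\<lambda>l. f i l) j) (b - j)"
  have "(\<Sum>j\<le>Suc b. ?T f (Suc b) j) = (\<Sum>j\<le>b. ?T f (Suc b) j) + binom_sum (f 0) (Suc b)"
    by simp
  also have "(\<Sum>j\<le>b. ?T f (Suc b) j) = (\<Sum>j\<le>b. ?T f b j + ?T (\<lambda>i. f (Suc i)) b j)"
    by (intro sum.cong) (simp_all add: Suc_diff_le binom_sum_Suc)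
  also have "\<dots> = binom_sum (diag_conv f) b + binom_sum (diag_conv (\<lambda>i. f (Suc i))) b"
    by (simp add: sum.distrib Suc)
  finally have "(\<Sum>j\<le>Suc b. ?T f (Suc b) j) = binom_sum (diag_conv f) b
     + (binom_sum (diag_conv (\<lambda>i. f (Suc i))) b + (binom_sum (f 0) b + binom_sum (\<lambda>i. f 0 (Suc i)) b))"
    by (simp add: binom_sum_Suc algebra_simps)
  also have "\<dots> = binom_sum (diag_conv f) b + binom_sum (\<lambda>n. diag_conv f (Suc n)) b"
    by (simp add: diag_conv_Suc binom_sum_add algebra_simps)
  finally show ?case by (simp add: binom_sum_Suc)
qed

text \<open>
  In the binomial basis, \<open>f b = r\<^sup>b * binom_sum p b\<close> solves
  \<open>f b = x y f (b + 1) + x (f 0 + \<dots> + f b) + r\<^sup>b * binom_sum \<sigma> b\<close> as soon as \<open>p\<close> satisfies this recursion.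
\<close>

definition kernel_rec :: "'a::comm_ring_1 \<Rightarrow> 'a \<Rightarrow> (nat \<Rightarrow> 'a) \<Rightarrow> (nat \<Rightarrow> 'a) \<Rightarrow> bool" where
  "kernel_rec q m p \<sigma> \<longleftrightarrow> q * (1 - m) * p 0 - m * p 1 = \<sigma> 0 \<and>
     (\<forall>i. (q - m) * p (Suc i) - m * p (Suc (Suc i)) = (1 - q) * \<sigma> i + \<sigma> (Suc i))"

text \<open>Subtracting the equations at \<open>b\<close> and \<open>b + 1\<close> removes the sum
  and leaves a second-order recurrence with characteristic polynomial (q t - 1)(m t - 1); the power
  of \<open>r\<close> takes up the first factor. The second clause of \<open>kernel_rec\<close> is
  this recurrence in Newton coefficients, the first is the equation at 0.\<close>

lemma kernel_solve:
  fixes q m r :: "'a::comm_ring_1" and p \<sigma> :: "nat \<Rightarrow> 'a"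
  assumes rq: "r * q = 1"
    and rec: "kernel_rec q m p \<sigma>"
  shows "r ^ b * binom_sum p b = q * m * (r ^ Suc b * binom_sum p (Suc b))
           + (1 - q) * (1 - m) * (\<Sum>j\<le>b. r ^ j * binom_sum p j) + r ^ b * binom_sum \<sigma> b"
proof (induction b)
  case 0
  have p0: "q * (1 - m) * p 0 - m * p 1 = \<sigma> 0" using rec by (simp add: kernel_rec_def)
  have "q * m * (r * (p 0 + p 1)) = (r * q) * (m * (p 0 + p 1))" by (simp add: algebra_simps)
  then have *: "q * m * (r * (p 0 + p 1)) = m * (p 0 + p 1)" using rq by simp
  have "p 0 = m * (p 0 + p 1) + (1 - q) * (1 - m) * p 0 + \<sigma> 0"
    unfolding p0[symmetric] by (simp add: algebra_simps)
  with * show ?case by (simp add: binom_sum_Suc)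
next
  case (Suc b)
  define f0 where "f0 = binom_sum p b"
  define f1 where "f1 = binom_sum (\<lambda>i. p (Suc i)) b"
  define f2 where "f2 = binom_sum (\<lambda>i. p (Suc (Suc i))) b"
  define g0 where "g0 = binom_sum \<sigma> b"
  define g1 where "g1 = binom_sum (\<lambda>i. \<sigma> (Suc i)) b"
  define R where "R = r ^ Suc b"
  have Rb: "r ^ b = q * R" and Rs: "q * r ^ Suc (Suc b) = R"
    using rq by (simp_all add: R_def mult.assoc[symmetric] mult.commute[of q])
  have "binom_sum (\<lambda>i. (q - m) * p (Suc i) - m * p (Suc (Suc i))) b
      = binom_sum (\<lambda>i. (1 - q) * \<sigma> i + \<sigma> (Suc i)) b"
    using rec by (simp add: kernel_rec_def)
  then have rel: "(q - m) * f1 - m * f2 = (1 - q) * g0 + g1"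
    by (simp add: binom_sum_add binom_sum_diff binom_sum_cmult f1_def f2_def g0_def g1_def)
  have IH: "q * R * f0 = q * m * (R * (f0 + f1))
      + (1 - q) * (1 - m) * (\<Sum>j\<le>b. r ^ j * binom_sum p j) + q * R * g0"
    using Suc unfolding Rb R_def[symmetric] by (simp add: binom_sum_Suc f0_def f1_def g0_def)
  \<comment> \<open>The induction hypothesis determines the sum up to \<open>b\<close>, and
    \<open>rel\<close> determines \<open>g1\<close>; what remains is a ring identity.\<close>
  define T where "T = (1 - q) * (1 - m) * (\<Sum>j\<le>b. r ^ j * binom_sum p j)"
  have T: "T = q * R * f0 - q * m * (R * (f0 + f1)) - q * R * g0"
    using IH unfolding T_def by (simp add: algebra_simps)
  have g1: "g1 = (q - m) * f1 - m * f2 - (1 - q) * g0"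
    using rel by (simp add: algebra_simps)
  have e1: "R * (f0 + f1) = m * (R * (f0 + f1 + (f1 + f2)))
      + (T + (1 - q) * (1 - m) * (R * (f0 + f1))) + R * (g0 + g1)"
    unfolding T g1 by (simp add: algebra_simps)
  have e2: "q * m * (r ^ Suc (Suc b) * binom_sum p (Suc (Suc b)))
      = m * (R * (f0 + f1 + (f1 + f2)))"
    unfolding Rs[symmetric] f0_def f1_def f2_def binom_sum_Suc by (simp add: mult_ac add_ac)
  have e3: "r ^ Suc b * binom_sum p (Suc b) = R * (f0 + f1)"
    and e4: "r ^ Suc b * binom_sum \<sigma> (Suc b) = R * (g0 + g1)"
    by (simp_all only: R_def f0_def f1_def g0_def g1_def binom_sum_Suc)
  show ?case
    unfolding e2 e3 e4 sum.atMost_Suc distrib_left[of "(1 - q) * (1 - m)"]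
    by (fact e1[unfolded T_def])
qed

section \<open>Deciding polynomial identities in two variables\<close>

text \<open>
  An \<open>int list list\<close> \<open>a\<close> stands for the polynomial with coefficient \<open>a ! i ! j\<close> at \<open>q\<^sup>i m\<^sup>j\<close>. Rewriting with
  \<open>peval2_rules\<close> turns an identity into one between two such evaluations, which \<open>peval2_eqI\<close> reduces
  to a computation for the simplifier.
\<close>

fun padd :: "int list \<Rightarrow> int list \<Rightarrow> int list" where
  "padd [] b = b"
| "padd (x # a) [] = x # a"
| "padd (x # a) (y # b) = (x + y) # padd a b"

primrec pmul :: "int list \<Rightarrow> int list \<Rightarrow> int list" where
  "pmul [] b = []"
| "pmul (x # a) b = (if x = 0 then 0 # pmul a b else padd (map ((*) x) b) (0 # pmul a b))"

fun padd2 :: "int list list \<Rightarrow> int list list \<Rightarrow> int list list" where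
  "padd2 [] b = b"
| "padd2 (x # a) [] = x # a"
| "padd2 (x # a) (y # b) = padd x y # padd2 a b"

primrec pmul2 :: "int list list \<Rightarrow> int list list \<Rightarrow> int list list" where
  "pmul2 [] b = []"
| "pmul2 (x # a) b = (if x = [] then [] # pmul2 a b else padd2 (map (pmul x) b) ([] # pmul2 a b))"

primrec ppow2 :: "int list list \<Rightarrow> nat \<Rightarrow> int list list" where
  "ppow2 a 0 = [[1]]"
| "ppow2 a (Suc n) = pmul2 a (ppow2 a n)"

definition pneg2 :: "int list list \<Rightarrow> int list list" where
  "pneg2 = map (map uminus)"

primrec pzero :: "int list \<Rightarrow> bool" where
  "pzero [] = True"
| "pzero (x # a) = (x = 0 \<and> pzero a)"

primrec pzero2 :: "int list list \<Rightarrow> bool" where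
  "pzero2 [] = True"
| "pzero2 (x # a) = (pzero x \<and> pzero2 a)"

primrec peval :: "'a::comm_ring_1 \<Rightarrow> int list \<Rightarrow> 'a" where
  "peval m [] = 0"
| "peval m (x # a) = of_int x + m * peval m a"

primrec peval2 :: "'a::comm_ring_1 \<Rightarrow> 'a \<Rightarrow> int list list \<Rightarrow> 'a" where
  "peval2 q m [] = 0"
| "peval2 q m (x # a) = peval m x + q * peval2 q m a"

lemma peval_padd: "peval m (padd a b) = peval m a + peval m b"
  by (induction a b rule: padd.induct) (simp_all add: algebra_simps)

lemma peval_map_mult: "peval m (map ((*) x) a) = of_int x * peval m a"
  by (induction a) (simp_all add: algebra_simps)

lemma peval_map_uminus: "peval m (map uminus a) = - peval m a"
  by (induction a) (simp_all add: algebra_simps)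

lemma peval_pmul: "peval m (pmul a b) = peval m a * peval m b"
  by (induction a) (simp_all add: peval_padd peval_map_mult algebra_simps)

lemma peval2_padd2: "peval2 q m (padd2 a b) = peval2 q m a + peval2 q m b"
  by (induction a b rule: padd2.induct) (simp_all add: peval_padd algebra_simps)

lemma peval2_map_pmul: "peval2 q m (map (pmul x) a) = peval m x * peval2 q m a"
  by (induction a) (simp_all add: peval_pmul algebra_simps)

lemma peval2_pmul2: "peval2 q m (pmul2 a b) = peval2 q m a * peval2 q m b"
  by (induction a) (simp_all add: peval2_padd2 peval2_map_pmul algebra_simps)

lemma peval2_ppow2: "peval2 q m (ppow2 a n) = peval2 q m a ^ n"
  by (induction n) (simp_all add: peval2_pmul2)

lemma peval2_pneg2: "peval2 q m (pneg2 a) = - peval2 q m a"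
  by (induction a) (simp_all add: pneg2_def peval_map_uminus algebra_simps)

lemma peval_pzero: "pzero a \<Longrightarrow> peval m a = 0"
  by (induction a) simp_all

lemma peval2_pzero2: "pzero2 a \<Longrightarrow> peval2 q m a = 0"
  by (induction a) (simp_all add: peval_pzero)

text \<open>\<open>E\<close> is kept opaque: with \<open>peval2 q m\<close> written out, the first
  two rules would rewrite their own right-hand sides forever.\<close>

lemma peval2_rules:
  assumes "E = peval2 q m"
  shows "q = E [[], [1]]" "m = E [[0, 1]]" "numeral w = E [[numeral w]]" "1 = E [[1]]" "0 = E []"
    "E a + E b = E (padd2 a b)" "E a * E b = E (pmul2 a b)" "E a ^ n = E (ppow2 a n)"
    "- E a = E (pneg2 a)" "E a - E b = E (padd2 a (pneg2 b))"
  by (simp_all add: assms peval2_padd2 peval2_pmul2 peval2_ppow2 peval2_pneg2)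

text \<open>Trailing zeros make the list of a polynomial ambiguous, so the difference is tested for
  zero instead of comparing lists.\<close>

lemma peval2_eqI:
  assumes "E = peval2 q m" "pzero2 (padd2 a (pneg2 b))"
  shows "E a = E b"
  using peval2_pzero2[OF assms(2), of q m] by (simp add: assms(1) peval2_padd2 peval2_pneg2)

section \<open>The coefficients of the solution\<close>

abbreviation lcoef :: "'a::comm_ring_1 list \<Rightarrow> nat \<Rightarrow> 'a" where
  "lcoef \<equiv> nth_default 0"

definition mcoef :: "'a::comm_ring_1 list list \<Rightarrow> nat \<Rightarrow> nat \<Rightarrow> 'a" where
  "mcoef R i = lcoef (nth_default [] R i)"

lemma mcoef_simps [simp]:
  "mcoef [] i = (\<lambda>l. 0)" "mcoef (p # R) 0 = lcoef p" "mcoef (p # R) (Suc i) = mcoef R i"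
  by (auto simp: mcoef_def)

lemma diag_conv_0 [simp]: "diag_conv f 0 = f 0 0"
  by (simp add: diag_conv_def)

lemma diag_conv_zero [simp]: "diag_conv (\<lambda>i l. 0) n = 0"
  by (simp add: diag_conv_def)

lemma diag_conv_mcoef [simp]:
  "diag_conv (mcoef []) n = 0"
  "diag_conv (mcoef (p # R)) (Suc n) = lcoef p (Suc n) + lcoef p n + diag_conv (mcoef R) n"
proof -
  have "mcoef [] = (\<lambda>i l. (0::'a))" by (intro ext) simp
  then show "diag_conv (mcoef []) n = (0::'a)" by simp
qed (simp add: diag_conv_Suc)

text \<open>Represents \<open>c * binom_sum p b\<close> in the basis C(c,i) C(b,l), since c =
  C(c,1).\<close>

definition row_one :: "(nat \<Rightarrow> 'a::comm_ring_1) \<Rightarrow> nat \<Rightarrow> nat \<Rightarrow> 'a" where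
  "row_one p i l = (if i = 1 then p l else 0)"

lemma row_one_simps [simp]:
  "row_one p 0 l = 0" "row_one p (Suc 0) l = p l" "row_one p (Suc (Suc i)) l = 0"
  by (simp_all add: row_one_def)

definition lin_conv :: "(nat \<Rightarrow> 'a::comm_ring_1) \<Rightarrow> nat \<Rightarrow> 'a" where
  "lin_conv p = diag_conv (row_one p)"

lemma lin_conv_simps [simp]:
  "lin_conv p 0 = 0" "lin_conv p (Suc 0) = p 0"
  "lin_conv p (Suc (Suc n)) = p (Suc n) + p n"
proof -
  have "(\<lambda>i. row_one p (Suc (Suc i))) = (\<lambda>i l. 0)"
    by (intro ext) simp
  then show "lin_conv p 0 = 0" "lin_conv p (Suc 0) = p 0"
    "lin_conv p (Suc (Suc n)) = p (Suc n) + p n"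
    by (simp_all add: lin_conv_def diag_conv_Suc)
qed

lemma binom_sum_row_one:
  "binom_sum (\<lambda>i. binom_sum (row_one p i) b) n = of_nat n * binom_sum p b"
proof -
  have "binom_sum (\<lambda>i. binom_sum (row_one p i) b) n
      = (\<Sum>i\<le>n. if i = 1 then binom_sum p b * of_nat (n choose i) else 0)"
    unfolding binom_sum_def[of _ n]
    by (intro sum.cong) (auto simp: binom_sum_def row_one_def)
  also have "\<dots> = of_nat n * binom_sum p b"
    by (cases n) (simp_all add: mult.commute)
  finally show ?thesis .
qed

lemma sum_of_nat_mult_binom_sum:
  "(\<Sum>j\<le>b. of_nat (b - j) * binom_sum p j) = binom_sum (lin_conv p) b"
  using sum_binom_sum_diag[of "row_one p" b] by (simp add: lin_conv_def binom_sum_row_one)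

text \<open>Vandermonde's convolution combined with multiplication by \<open>c\<close>: the source
  term of a join with a cycle carrying \<open>c\<close> maxima.\<close>

definition mult_shift :: "(nat \<Rightarrow> 'a::comm_ring_1) \<Rightarrow> nat \<Rightarrow> nat \<Rightarrow> 'a" where
  "mult_shift p i l = of_nat i * (p (i + l) + p (i - 1 + l))"

lemma mult_shift_simps [simp]:
  "mult_shift p 0 l = 0"
  "mult_shift p (Suc i) l = of_nat (Suc i) * (p (Suc (i + l)) + p (i + l))"
  by (simp_all add: mult_shift_def)

lemma of_nat_mult_binom_sum_plus:
  "of_nat c * binom_sum p (b + c) = binom_sum (\<lambda>i. binom_sum (mult_shift p i) b) c"
proof -
  have "of_nat c * binom_sum p (b + c)
      = binom_sum (\<lambda>l. of_nat c * binom_sum (\<lambda>i. p (i + l)) c) b"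
    by (simp only: binom_sum_plus_arg binom_sum_cmult)
  also have "\<dots> = binom_sum (\<lambda>l. binom_sum (\<lambda>i. mult_shift p i l) c) b"
    by (simp only: of_nat_mult_binom_sum mult_shift_def)
  also have "\<dots> = binom_sum (\<lambda>i. binom_sum (mult_shift p i) b) c"
    by (rule binom_sum_swap)
  finally show ?thesis .
qed

text \<open>
  Coefficients, in the basis \<open>b choose l\<close>, of the polynomials in the solution, all scaled by
  \<open>s\<^sup>1\<^sup>1\<close> to clear denominators. They come from solving \<open>kernel_rec\<close> from the highest coefficient
  downwards.
\<close>

definition h_list :: "'a::comm_ring_1 \<Rightarrow> 'a \<Rightarrow> 'a list" where
  "h_list q m = 
    [(1 - q) * (q - m)^10,
     (1 - q)^2 * (q - m)^10]"

definition w1_list :: "'a::comm_ring_1 \<Rightarrow> 'a \<Rightarrow> 'a list" where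
  "w1_list q m = 
    [q^2 * (1 - q)^2 * (1 - m)^2 * m * (q - m)^6,
     q^3 * (1 - q)^2 * (1 - m)^3 * (q - m)^6,
     (1 - q)^2 * (1 - m) * (q - m)^7 * (m^2 - 3 * q * m + 3 * q^2 - 2 * q^3 + q^3 * m),
     (1 - q)^3 * (1 - m) * (q - m)^8 * (3 * q - 2 * m - q^2),
     (1 - q)^4 * (1 - m) * (q - m)^9]"

definition f2_lists :: "'a::comm_ring_1 \<Rightarrow> 'a \<Rightarrow> 'a list list" where
  "f2_lists q m = 
    [[],
     [(1 - q)^2 * (1 - m) * (q - m)^8 * (2 * q - m - q^2),
      (1 - q)^3 * (1 - m) * (q - m)^8 * (3 * q - 2 * m - q^2),
      (1 - q)^4 * (1 - m) * (q - m)^9],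
     [2 * (1 - q)^3 * (1 - m) * (q - m)^9,
      2 * (1 - q)^4 * (1 - m) * (q - m)^9]]"

definition f1_lists :: "'a::comm_ring_1 \<Rightarrow> 'a \<Rightarrow> 'a list list" where
  "f1_lists q m = 
    [[],
     [q^2 * (1 - q)^3 * (1 - m)^3 * (q - m)^4 * (m^2 + 8 * q * m - 5 * q * m^2 + q^2
         - 5 * q^2 * m),
      q^2 * (1 - q)^3 * (1 - m)^3 * (q - m)^4 * (2 * q * m + 9 * q^2 + 5 * q^2 * m^2
          + 5 * q^3 * m - m^2 - 15 * q^2 * m - 5 * q^3),
      (1 - q)^3 * (1 - m)^2 * (q - m)^5 * (15 * q * m^2 + 26 * q^3 + 2 * q^3 * m
          + 2 * q^3 * m^2 + 21 * q^4 * m + 7 * q^5 - 3 * m^3 - 28 * q^2 * m - 2 * q^2 * m^2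
          - 30 * q^4 - 6 * q^4 * m^2 - 4 * q^5 * m),
      (1 - q)^4 * (1 - m)^2 * (q - m)^6 * (11 * m^2 - 36 * q * m + 34 * q^2 + 8 * q^2 * m
          - 26 * q^3 + 6 * q^3 * m + 3 * q^4),
      (1 - q)^5 * (1 - m)^2 * (q - m)^7 * (21 * q - 13 * m - 8 * q^2),
      5 * (1 - q)^6 * (1 - m)^2 * (q - m)^8],
     [q^2 * (1 - q)^3 * (1 - m)^3 * (q - m)^5 * (2 * m + 8 * q - 6 * q * m - 4 * q^2),
      (1 - q)^3 * (1 - m)^2 * (q - m)^5 * (10 * q * m^2 + 22 * q^3 + 2 * q^3 * m^2
          + 22 * q^4 * m + 6 * q^5 - 2 * m^3 - 20 * q^2 * m - 4 * q^3 * m - 26 * q^4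
          - 6 * q^4 * m^2 - 4 * q^5 * m),
      (1 - q)^4 * (1 - m)^2 * (q - m)^6 * (8 * m^2 - 26 * q * m + 26 * q^2 + 4 * q^2 * m
          - 20 * q^3 + 6 * q^3 * m + 2 * q^4),
      (1 - q)^5 * (1 - m)^2 * (q - m)^7 * (16 * q - 10 * m - 6 * q^2),
      4 * (1 - q)^6 * (1 - m)^2 * (q - m)^8],
     [(1 - q)^3 * (1 - m)^2 * (q - m)^6 * (3 * m^2 - 12 * q * m + 18 * q^2 - 18 * q^3
         + 6 * q^3 * m + 3 * q^4),
      (1 - q)^4 * (1 - m)^2 * (q - m)^6 * (9 * m^2 - 30 * q * m + 30 * q^2 + 6 * q^2 * m
          - 24 * q^3 + 6 * q^3 * m + 3 * q^4),
      (1 - q)^5 * (1 - m)^2 * (q - m)^7 * (15 * q - 9 * m - 6 * q^2),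
      3 * (1 - q)^6 * (1 - m)^2 * (q - m)^8],
     [(1 - q)^4 * (1 - m)^2 * (q - m)^7 * (16 * q - 8 * m - 8 * q^2),
      (1 - q)^5 * (1 - m)^2 * (q - m)^7 * (20 * q - 12 * m - 8 * q^2),
      4 * (1 - q)^6 * (1 - m)^2 * (q - m)^8],
     [5 * (1 - q)^5 * (1 - m)^2 * (q - m)^8,
      5 * (1 - q)^6 * (1 - m)^2 * (q - m)^8]]"

definition w2_list :: "'a::comm_ring_1 \<Rightarrow> 'a \<Rightarrow> 'a list" where
  "w2_list q m = 
    [q^2 * (1 - q)^4 * (1 - m)^4 * m * (m^4 + 24 * q * m^3 - 14 * q * m^4 + 55 * q^2 * m^2
    - 91 * q^2 * m^3 + 21 * q^2 * m^4 + 24 * q^3 * m - 91 * q^3 * m^2 + 63 * q^3 * m^3 + q^4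
    - 14 * q^4 * m + 21 * q^4 * m^2),
     q^3 * (1 - q)^4 * (1 - m)^5 * (m^4 + 24 * q * m^3 - 14 * q * m^4 + 55 * q^2 * m^2
         - 91 * q^2 * m^3 + 21 * q^2 * m^4 + 24 * q^3 * m - 91 * q^3 * m^2 + 63 * q^3 * m^3
         + q^4 - 14 * q^4 * m + 21 * q^4 * m^2),
     q^2 * (1 - q)^4 * (1 - m)^4 * (q - m) * (m^4 + 6 * q * m^3 - 6 * q * m^4 + 4 * q^2 * m^2
         - 28 * q^2 * m^3 + 14 * q^2 * m^4 + 75 * q^3 * m - 146 * q^3 * m^2 + 112 * q^3 * m^3
         - 21 * q^3 * m^4 + 19 * q^4 - 125 * q^4 * m + 154 * q^4 * m^2 - 63 * q^4 * m^3
         - 10 * q^5 + 35 * q^5 * m - 21 * q^5 * m^2),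
     q^2 * (1 - q)^4 * (1 - m)^4 * (q - m)^2 * (2 * m^3 - 8 * q * m^2 - q * m^3
         + 10 * q^2 * m - 3 * q^2 * m^2 + 4 * q^2 * m^3 + 101 * q^3 - 201 * q^3 * m
         + 122 * q^3 * m^2 - 21 * q^3 * m^3 - 110 * q^4 + 164 * q^4 * m - 63 * q^4 * m^2
         + 25 * q^5 - 21 * q^5 * m),
     (1 - q)^4 * (1 - m)^3 * (q - m)^3 * (8 * m^4 - 56 * q * m^3 + 163 * q^2 * m^2
         + 5 * q^2 * m^3 - 265 * q^3 * m - 9 * q^3 * m^2 - 6 * q^3 * m^3 + 255 * q^4
         + 8 * q^4 * m + 18 * q^4 * m^2 - q^4 * m^3 - 424 * q^5 + 417 * q^5 * m
         - 187 * q^5 * m^2 + 26 * q^5 * m^3 + 201 * q^6 - 208 * q^6 * m + 63 * q^6 * m^2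
         - 24 * q^7 + 16 * q^7 * m),
     (1 - q)^5 * (1 - m)^3 * (q - m)^4 * (228 * q * m^2 + 355 * q^3 + 192 * q^3 * m
         + 174 * q^4 * m + 138 * q^5 - 44 * m^3 - 444 * q^2 * m - 36 * q^2 * m^2
         - 27 * q^3 * m^2 - 441 * q^4 - 33 * q^4 * m^2 - 54 * q^5 * m - 8 * q^6),
     (1 - q)^6 * (1 - m)^3 * (q - m)^5 * (85 * m^2 - 291 * q * m + 281 * q^2 + 82 * q^2 * m
         - 232 * q^3 + 39 * q^3 * m + 36 * q^4),
     (1 - q)^7 * (1 - m)^3 * (q - m)^6 * (119 * q - 70 * m - 49 * q^2),
     21 * (1 - q)^8 * (1 - m)^3 * (q - m)^7]"

text \<open>The coefficient lists have at most nine entries, so from index 8 on every term of the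
  recursions vanishes and one check with symbolic \<open>k\<close> covers the tail.\<close>

lemma all_nat_upto_8:
  assumes "Q 0" "Q (Suc 0)" "Q (Suc (Suc 0))" "Q (Suc (Suc (Suc 0)))"
    "Q (Suc (Suc (Suc (Suc 0))))" "Q (Suc (Suc (Suc (Suc (Suc 0)))))"
    "Q (Suc (Suc (Suc (Suc (Suc (Suc 0))))))"
    "Q (Suc (Suc (Suc (Suc (Suc (Suc (Suc 0)))))))"
    "\<And>k. Q (Suc (Suc (Suc (Suc (Suc (Suc (Suc (Suc k))))))))"
  shows "\<forall>n::nat. Q n"
proof
  fix n :: nat
  consider "n < 8" | k where "n = Suc (Suc (Suc (Suc (Suc (Suc (Suc (Suc k)))))))"
    by (cases "n < 8") (auto dest!: le_Suc_ex simp: not_less eval_nat_numeral)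
  then show "Q n"
  proof cases
    case 1
    then have "n \<in> {0, 1, 2, 3, 4, 5, 6, 7}" by auto
    then show ?thesis using assms(1-8) by (auto simp: eval_nat_numeral)
  qed (use assms(9) in simp)
qed

section \<open>Checking the recursions for the coefficient lists\<close>

lemmas coef_eval = nth_default_Cons_0 nth_default_Cons_Suc nth_default_Nil mcoef_simps
  lin_conv_simps diag_conv_0 diag_conv_mcoef mult_shift_simps row_one_simps One_nat_def
  of_nat_Suc of_nat_0 add_0_left add_0_right add_Suc add_Suc_right mult_zero_left mult_zero_right diff_zero

lemma h_rec: "kernel_rec q m (lcoef (h_list q m)) (lcoef [(1 - q) * (q - m) ^ 11])"
proof -
  obtain E where E: "E = peval2 q m" by simp
  show ?thesis
    unfolding kernel_rec_def h_list_def
    by (rule conjI, (simp only: coef_eval; (simp only: peval2_rules[OF E]; (rule peval2_eqI[OF E], code_simp))),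
        rule all_nat_upto_8)
      (simp only: coef_eval; (simp only: peval2_rules[OF E]; (rule peval2_eqI[OF E], code_simp)))+
qed

text \<open>Source: a cycle is split off now and joined later.\<close>

lemma w1_rec:
  "kernel_rec q m (lcoef (w1_list q m)) (\<lambda>n. (1 - q) * (1 - m) * lin_conv (lcoef (h_list q m)) n)"
proof -
  obtain E where E: "E = peval2 q m" by simp
  show ?thesis
    unfolding kernel_rec_def h_list_def w1_list_def
    by (rule conjI, (simp only: coef_eval; (simp only: peval2_rules[OF E]; (rule peval2_eqI[OF E], code_simp))),
        rule all_nat_upto_8)
      (simp only: coef_eval; (simp only: peval2_rules[OF E]; (rule peval2_eqI[OF E], code_simp)))+
qed

text \<open>Source: the first cycle, of size \<open>c\<close>, is joined now, and the join of the
  second is still to come.\<close>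

lemma f2_rec:
  "\<forall>i. kernel_rec q m (mcoef (f2_lists q m) i) (\<lambda>l. (1 - q) * (1 - m) * mult_shift (lcoef (h_list q m)) i l)"
proof -
  obtain E where E: "E = peval2 q m" by simp
  show ?thesis
    unfolding kernel_rec_def h_list_def f2_lists_def
    by (rule all_nat_upto_8;
        (rule conjI, (simp only: coef_eval; (simp only: peval2_rules[OF E]; (rule peval2_eqI[OF E], code_simp))),
         rule all_nat_upto_8))
      (simp only: coef_eval; (simp only: peval2_rules[OF E]; (rule peval2_eqI[OF E], code_simp)))+
qed

text \<open>Three sources: \<open>c\<close> is joined now; or a cycle is split off now that will be
  joined before \<open>c\<close> (the \<open>row_one\<close> term) or after \<open>c\<close> (the
  \<open>lin_conv\<close> term).\<close>

lemma f1_rec: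
  "\<forall>i. kernel_rec q m (mcoef (f1_lists q m) i)
     (\<lambda>l. (1 - q) * (1 - m) * (mult_shift (lcoef (w1_list q m)) i l
        + row_one (diag_conv (mcoef (f2_lists q m))) i l
        + lin_conv (mcoef (f2_lists q m) i) l))"
proof -
  obtain E where E: "E = peval2 q m" by simp
  show ?thesis
    unfolding kernel_rec_def w1_list_def f2_lists_def f1_lists_def
    by (rule all_nat_upto_8;
        (rule conjI, (simp only: coef_eval; (simp only: peval2_rules[OF E]; (rule peval2_eqI[OF E], code_simp))),
         rule all_nat_upto_8))
      (simp only: coef_eval; (simp only: peval2_rules[OF E]; (rule peval2_eqI[OF E], code_simp)))+
qed

text \<open>Source: a cycle is split off now that takes part in one of the two later joins.\<close>

lemma w2_rec:
  "kernel_rec q m (lcoef (w2_list q m)) (\<lambda>n. (1 - q) * (1 - m) * diag_conv (mcoef (f1_lists q m)) n)"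
proof -
  obtain E where E: "E = peval2 q m" by simp
  show ?thesis
    unfolding kernel_rec_def f1_lists_def w2_list_def
    by (rule conjI, (simp only: coef_eval; (simp only: peval2_rules[OF E]; (rule peval2_eqI[OF E], code_simp))),
        rule all_nat_upto_8)
      (simp only: coef_eval; (simp only: peval2_rules[OF E]; (rule peval2_eqI[OF E], code_simp)))+
qed

section \<open>The potential of a state\<close>

lemma kernel_rec_solve:
  fixes q m r :: "'a::comm_ring_1"
  assumes "r * q = 1" "kernel_rec q m p \<sigma>"
  shows "a * (r ^ Suc b * binom_sum p b) = q * m * (a * (r ^ Suc (Suc b) * binom_sum p (Suc b)))
           + (1 - q) * (1 - m) * (\<Sum>j\<le>b. a * (r ^ Suc j * binom_sum p j))
           + a * (r ^ Suc b * binom_sum \<sigma> b)"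
proof -
  have "r ^ b * binom_sum p b = q * m * (r ^ Suc b * binom_sum p (Suc b))
           + (1 - q) * (1 - m) * (\<Sum>j\<le>b. r ^ j * binom_sum p j) + r ^ b * binom_sum \<sigma> b"
    by (rule kernel_solve[OF assms])
  from arg_cong[OF this, of "\<lambda>u. a * r * u"] show ?thesis
    by (simp add: distrib_left sum_distrib_left mult_ac)
qed

lemma sum_mset_sum_swap:
  "(\<Sum>c\<in>#M. \<Sum>j\<in>A. f c j) = (\<Sum>j\<in>A. \<Sum>c\<in>#M. (f c j :: 'a::comm_monoid_add))"
  by (induction M) (simp_all add: sum.distrib)

text \<open>Ordered pairs of distinct occurrences; the order matters because \<open>f2 c c'\<close>
  joins \<open>c\<close> first.\<close>

definition pair_sum :: "(nat \<Rightarrow> nat \<Rightarrow> 'a::comm_ring_1) \<Rightarrow> nat multiset \<Rightarrow> 'a" where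
  "pair_sum f M = (\<Sum>c\<in>#M. \<Sum>c'\<in>#M - {#c#}. f c c')"

lemma pair_sum_add_mset:
  "pair_sum f (add_mset a M) = pair_sum f M + (\<Sum>c\<in>#M. f a c + f c a)"
proof -
  have "(\<Sum>c\<in>#M. \<Sum>c'\<in>#add_mset a M - {#c#}. f c c')
      = (\<Sum>c\<in>#M. f c a + (\<Sum>c'\<in>#M - {#c#}. f c c'))"
    by (intro arg_cong[where f = sum_mset] image_mset_cong) (simp add: add_mset_diff_bothsides)
  then show ?thesis by (simp add: pair_sum_def sum_mset.distrib add_ac)
qed

text \<open>\<open>kernel_rec\<close> is linear in its last two arguments, so for fixed
  \<open>c\<close> the rows of a two-variable solution may be combined.\<close>

lemma kernel_rec_binom_sum:
  assumes "\<forall>i. kernel_rec q m (\<phi> i) (\<psi> i)"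
  shows "kernel_rec q m (\<lambda>l. binom_sum (\<lambda>i. \<phi> i l) c) (\<lambda>l. binom_sum (\<lambda>i. \<psi> i l) c)"
  using assms unfolding kernel_rec_def
  by (simp add: binom_sum_cmult[symmetric] binom_sum_add[symmetric] binom_sum_diff[symmetric])

lemma kernel_rec_solve2:
  fixes q m r :: "'a::comm_ring_1" and c :: nat
  assumes "r * q = 1" "\<forall>i. kernel_rec q m (\<phi> i) (\<psi> i)"
  defines "G \<equiv> \<lambda>\<phi> b. binom_sum (\<lambda>i. binom_sum (\<phi> i) b) c"
  shows "a * (r ^ Suc b * G \<phi> b) = q * m * (a * (r ^ Suc (Suc b) * G \<phi> (Suc b)))
           + (1 - q) * (1 - m) * (\<Sum>j\<le>b. a * (r ^ Suc j * G \<phi> j)) + a * (r ^ Suc b * G \<psi> b)"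
  using kernel_rec_solve[OF assms(1) kernel_rec_binom_sum[OF assms(2)], of a b c]
  unfolding G_def binom_sum_swap[of _ _ c] .

text \<open>In the application \<open>q\<close> and \<open>m\<close> are power series with constant
  terms 1 and 0, so that \<open>q\<close> and \<open>1 - m\<close> have the inverses
  \<open>r\<close> and \<open>K\<close>.\<close>

locale growth_ring =
  fixes q m r K :: "'a::comm_ring_1"
  assumes r_q: "r * q = 1" and K_m: "K * (1 - m) = 1"
begin

abbreviation (input) x where "x \<equiv> (1 - q) * (1 - m)"

text \<open>
  \<open>V0\<close>, \<open>W1\<close> and \<open>W2\<close> are \<open>s\<^sup>1\<^sup>1\<close> times the generating functions of the extensions with 0, 1 and 2
  further joins, none of them with an element of the present \<open>N\<close>; \<open>g1 c\<close> is the same for one join,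
  with the present element \<open>c\<close>; \<open>f1 c\<close> for two joins, exactly one of them with the present element \<open>c\<close>;
  \<open>f2 c c'\<close> for the extensions that join first \<open>c\<close> and then \<open>c'\<close>.
\<close>

definition V0 :: "nat \<Rightarrow> 'a" where
  "V0 b = (q - m) ^ 11 * K * r ^ Suc b"

definition g1 :: "nat \<Rightarrow> nat \<Rightarrow> 'a" where
  "g1 c b = of_nat c * r ^ c * (r ^ Suc b * binom_sum (lcoef (h_list q m)) b)"

definition W1 :: "nat \<Rightarrow> 'a" where
  "W1 b = r ^ Suc b * binom_sum (lcoef (w1_list q m)) b"

definition f2 :: "nat \<Rightarrow> nat \<Rightarrow> nat \<Rightarrow> 'a" where
  "f2 c c' b = of_nat c' * r ^ c' * r ^ c *
     (r ^ Suc b * binom_sum (\<lambda>i. binom_sum (mcoef (f2_lists q m) i) b) c)"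

definition f1 :: "nat \<Rightarrow> nat \<Rightarrow> 'a" where
  "f1 c b = r ^ c * (r ^ Suc b * binom_sum (\<lambda>i. binom_sum (mcoef (f1_lists q m) i) b) c)"

definition W2 :: "nat \<Rightarrow> 'a" where
  "W2 b = r ^ Suc b * binom_sum (lcoef (w2_list q m)) b"

lemma r_powers: "j \<le> b \<Longrightarrow> r ^ (b - j) * (r ^ Suc j * u) = r ^ Suc b * u"
  by (simp add: power_add[symmetric] mult.assoc[symmetric] del: power_Suc)

text \<open>A geometric sum. Its boundary term -1 is balanced, through
  \<open>K * (1 - m) = 1\<close>, by the contribution \<open>(q - m) ^ 11\<close> of stopping at
  genus 2.\<close>

lemma V0_eq: "V0 b = (q - m) ^ 11 + q * m * V0 (Suc b) + x * (\<Sum>j\<le>b. V0 j)"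
proof -
  have sum: "(1 - q) * (\<Sum>j\<le>b. r ^ Suc j) = r ^ Suc b - 1"
  proof (induction b)
    case (Suc b)
    have "q * r ^ Suc (Suc b) = r ^ Suc b"
      using r_q by (simp add: mult.assoc[symmetric] mult.commute[of q])
    with Suc show ?case by (simp add: algebra_simps)
  qed (simp add: left_diff_distrib r_q mult.commute[of q])
  have "q * (r * (r * r ^ b)) = (r * q) * (r * r ^ b)" by (simp only: mult_ac)
  then have qr: "q * r ^ Suc (Suc b) = r ^ Suc b" by (simp add: r_q)
  have "K * r ^ Suc b = K * (1 - m) + q * m * (K * r ^ Suc (Suc b)) + x * (\<Sum>j\<le>b. K * r ^ Suc j)"
  proof -
    have "q * m * (K * r ^ Suc (Suc b)) = m * K * (q * r ^ Suc (Suc b))"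
      by (simp only: mult_ac)
    moreover have "x * (\<Sum>j\<le>b. K * r ^ Suc j) = (1 - m) * K * ((1 - q) * (\<Sum>j\<le>b. r ^ Suc j))"
      by (simp only: mult_ac sum_distrib_left)
    ultimately show ?thesis unfolding sum qr by (simp add: algebra_simps)
  qed
  from arg_cong[OF this, of "\<lambda>u. (q - m) ^ 11 * u"] show ?thesis
    unfolding V0_def by (simp add: K_m distrib_left sum_distrib_left mult_ac)
qed

text \<open>The factor \<open>1 - m\<close> of \<open>x\<close> cancels \<open>K\<close>, so apart
  from powers of \<open>r\<close> no inverse enters the functions built on
  \<open>V0\<close>.\<close>

lemma x_V0: "x * V0 b = (1 - q) * (q - m) ^ 11 * r ^ Suc b"
proof -
  have "x * V0 b = (K * (1 - m)) * ((1 - q) * (q - m) ^ 11 * r ^ Suc b)"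
    unfolding V0_def by (simp only: mult_ac)
  then show ?thesis by (simp add: K_m)
qed

lemma g1_eq: "g1 c b = q * m * g1 c (Suc b) + x * (\<Sum>j\<le>b. g1 c j) + x * (of_nat c * V0 (b + c))"
proof -
  have "binom_sum (lcoef [a]) b = a" for a :: 'a
  proof -
    have "binom_sum (lcoef [a]) b = (\<Sum>i\<le>b. if i = 0 then a else 0)"
      unfolding binom_sum_def by (intro sum.cong) (auto simp: nth_default_Cons split: nat.split)
    then show ?thesis by simp
  qed
  then have "of_nat c * r ^ c * (r ^ Suc b * binom_sum (lcoef [(1 - q) * (q - m) ^ 11]) b)
      = of_nat c * (x * V0 (b + c))"
    unfolding x_V0 by (simp add: power_add mult_ac)
  also have "\<dots> = x * (of_nat c * V0 (b + c))" by (simp only: mult_ac)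
  finally show ?thesis
    using kernel_rec_solve[OF r_q h_rec[of q m], of "of_nat c * r ^ c" b] unfolding g1_def by simp
qed

lemma W1_eq: "W1 b = q * m * W1 (Suc b) + x * (\<Sum>j\<le>b. W1 j) + x * (\<Sum>j\<le>b. g1 (b - j) j)"
proof -
  have "g1 (b - j) j = r ^ Suc b * (of_nat (b - j) * binom_sum (lcoef (h_list q m)) j)"
    if "j \<le> b" for j
    unfolding g1_def r_powers[OF that, symmetric] by (simp only: mult_ac)
  then have "(\<Sum>j\<le>b. g1 (b - j) j) = r ^ Suc b * binom_sum (lin_conv (lcoef (h_list q m))) b"
    by (simp add: sum_of_nat_mult_binom_sum[symmetric] sum_distrib_left)
  then show ?thesis
    using kernel_rec_solve[OF r_q w1_rec[of q m], of 1 b] unfolding W1_def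
    by (simp add: binom_sum_cmult mult_ac)
qed

lemma f2_eq:
  "f2 c c' b = q * m * f2 c c' (Suc b) + x * (\<Sum>j\<le>b. f2 c c' j) + x * (of_nat c * g1 c' (b + c))"
proof -
  have "of_nat c * g1 c' (b + c) = of_nat c' * r ^ c' * r ^ c *
      (r ^ Suc b * (of_nat c * binom_sum (lcoef (h_list q m)) (b + c)))"
    unfolding g1_def by (simp add: power_add mult_ac)
  then show ?thesis
    using kernel_rec_solve2[OF r_q f2_rec[of q m], where a = "of_nat c' * r ^ c' * r ^ c" and b = b and c = c]
    unfolding f2_def of_nat_mult_binom_sum_plus
    by (simp add: binom_sum_cmult mult_ac)
qed

lemma f1_eq:
  "f1 c b = q * m * f1 c (Suc b) + x * (\<Sum>j\<le>b. f1 c j)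
     + x * (of_nat c * W1 (b + c) + (\<Sum>j\<le>b. f2 (b - j) c j + f2 c (b - j) j))"
proof -
  let ?u = "mcoef (f2_lists q m)" and ?w = "lcoef (w1_list q m)"
  let ?R = "r ^ c * r ^ Suc b"
  have 1: "of_nat c * W1 (b + c) = ?R * binom_sum (\<lambda>i. binom_sum (mult_shift ?w i) b) c"
    unfolding W1_def of_nat_mult_binom_sum_plus[symmetric] by (simp add: power_add mult_ac)
  have "f2 (b - j) c j = ?R * of_nat c * binom_sum (\<lambda>i. binom_sum (?u i) j) (b - j)"
    if "j \<le> b" for j
    using r_powers[OF that, of "of_nat c * r ^ c * binom_sum (\<lambda>i. binom_sum (?u i) j) (b - j)"]
    unfolding f2_def by (simp only: mult_ac)
  then have 2: "(\<Sum>j\<le>b. f2 (b - j) c j) = ?R * of_nat c * binom_sum (diag_conv ?u) b"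
    by (simp add: sum_binom_sum_diag[symmetric] sum_distrib_left)
  have "f2 c (b - j) j = ?R * binom_sum (\<lambda>i. of_nat (b - j) * binom_sum (?u i) j) c"
    if "j \<le> b" for j
    using r_powers[OF that, of "of_nat (b - j) * r ^ c * binom_sum (\<lambda>i. binom_sum (?u i) j) c"]
    unfolding f2_def binom_sum_cmult by (simp only: mult_ac)
  then have "(\<Sum>j\<le>b. f2 c (b - j) j)
      = ?R * (\<Sum>j\<le>b. binom_sum (\<lambda>i. of_nat (b - j) * binom_sum (?u i) j) c)"
    by (simp add: sum_distrib_left)
  also have "(\<Sum>j\<le>b. binom_sum (\<lambda>i. of_nat (b - j) * binom_sum (?u i) j) c)
      = binom_sum (\<lambda>i. \<Sum>j\<le>b. of_nat (b - j) * binom_sum (?u i) j) c"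
    unfolding binom_sum_def[of _ c] sum_distrib_right by (rule sum.swap)
  also have "\<dots> = binom_sum (\<lambda>i. binom_sum (lin_conv (?u i)) b) c"
    by (simp only: sum_of_nat_mult_binom_sum)
  finally have 3: "(\<Sum>j\<le>b. f2 c (b - j) j) = ?R * binom_sum (\<lambda>i. binom_sum (lin_conv (?u i)) b) c" .
  show ?thesis
    unfolding sum.distrib 1 2 3
    using kernel_rec_solve2[OF r_q f1_rec[of q m], where a = "r ^ c" and b = b and c = c]
    unfolding f1_def binom_sum_cmult binom_sum_add binom_sum_row_one
    by (simp add: distrib_left mult_ac)
qed

lemma W2_eq: "W2 b = q * m * W2 (Suc b) + x * (\<Sum>j\<le>b. W2 j) + x * (\<Sum>j\<le>b. f1 (b - j) j)"
proof -
  have "f1 (b - j) j = r ^ Suc b * binom_sum (\<lambda>i. binom_sum (mcoef (f1_lists q m) i) j) (b - j)"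
    if "j \<le> b" for j
    unfolding f1_def r_powers[OF that] ..
  then have "(\<Sum>j\<le>b. f1 (b - j) j) = r ^ Suc b * binom_sum (diag_conv (mcoef (f1_lists q m))) b"
    by (simp add: sum_binom_sum_diag[symmetric] sum_distrib_left)
  then show ?thesis
    using kernel_rec_solve[OF r_q w2_rec[of q m], of 1 b] unfolding W2_def
    by (simp add: binom_sum_cmult mult_ac)
qed

text \<open>The argument \<open>d\<close> is twice the genus reached so far.\<close>

definition pot :: "int \<Rightarrow> nat \<Rightarrow> nat multiset \<Rightarrow> 'a" where
  "pot d b M =
     (if d = 4 then V0 b
      else if d = 2 then W1 b + (\<Sum>c\<in>#M. g1 c b)
      else if d = 0 then W2 b + (\<Sum>c\<in>#M. f1 c b) + pair_sum (\<lambda>c c'. f2 c c' b) M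
      else 0)"

text \<open>One step of the growth: stop if genus 2 is reached, open a block (weight x y = q m),
  split, or join. Only a join raises \<open>d\<close>.\<close>

lemma pot_eq:
  assumes "d \<ge> 0"
  shows "pot d b M = (if d = 4 then (q - m) ^ 11 else 0) + q * m * pot d (Suc b) M
     + x * ((\<Sum>j\<le>b. pot d j (add_mset (b - j) M))
            + (\<Sum>c\<in>#M. of_nat c * pot (d + 2) (b + c) (M - {#c#})))"
proof -
  consider "d = 4" | "d = 2" | "d = 0" | "d \<notin> {4, 2, 0}" by auto
  then show ?thesis
  proof cases
    case 1
    then show ?thesis using V0_eq[of b] by (simp add: pot_def)
  next
    case 2
    have "(\<Sum>c\<in>#M. g1 c b) = q * m * (\<Sum>c\<in>#M. g1 c (Suc b)) + x * (\<Sum>c\<in>#M. \<Sum>j\<le>b. g1 c j)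
        + x * (\<Sum>c\<in>#M. of_nat c * V0 (b + c))"
      by (subst g1_eq) (simp only: sum_mset.distrib sum_mset_distrib_left)
    with 2 show ?thesis
      using W1_eq[of b]
      by (simp add: pot_def sum_mset_sum_swap sum.distrib algebra_simps)
  next
    case 3
    have e1: "(\<Sum>c\<in>#M. f1 c b) = q * m * (\<Sum>c\<in>#M. f1 c (Suc b)) + x * (\<Sum>c\<in>#M. \<Sum>j\<le>b. f1 c j)
        + x * ((\<Sum>c\<in>#M. of_nat c * W1 (b + c)) + (\<Sum>c\<in>#M. \<Sum>j\<le>b. f2 (b - j) c j + f2 c (b - j) j))"
      by (subst f1_eq) (simp only: sum_mset.distrib distrib_left sum_mset_distrib_left)
    \<comment> \<open>\<open>f2 c c'\<close> joins \<open>c\<close> first; afterwards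
      \<open>c'\<close> ranges over \<open>M - {#c#}\<close>, which gives the inner sum of the last
      term.\<close>
    have e2: "pair_sum (\<lambda>c c'. f2 c c' b) M = q * m * pair_sum (\<lambda>c c'. f2 c c' (Suc b)) M
        + x * (\<Sum>j\<le>b. pair_sum (\<lambda>c c'. f2 c c' j) M)
        + x * (\<Sum>c\<in>#M. of_nat c * (\<Sum>c'\<in>#M - {#c#}. g1 c' (b + c)))"
      unfolding pair_sum_def
      by (subst f2_eq) (simp only: sum_mset.distrib sum_mset_distrib_left sum_mset_sum_swap sum_distrib_left)
    have "pot d b M = W2 b + (\<Sum>c\<in>#M. f1 c b) + pair_sum (\<lambda>c c'. f2 c c' b) M"
      using 3 by (simp add: pot_def)
    also have "\<dots> = q * m * (W2 (Suc b) + (\<Sum>c\<in>#M. f1 c (Suc b)) + pair_sum (\<lambda>c c'. f2 c c' (Suc b)) M)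
        + x * ((\<Sum>j\<le>b. W2 j + (f1 (b - j) j + (\<Sum>c\<in>#M. f1 c j))
                  + (pair_sum (\<lambda>c c'. f2 c c' j) M + (\<Sum>c\<in>#M. f2 (b - j) c j + f2 c (b - j) j)))
             + (\<Sum>c\<in>#M. of_nat c * (W1 (b + c) + (\<Sum>c'\<in>#M - {#c#}. g1 c' (b + c)))))"
      unfolding e1 e2 W2_eq[of b]
      by (simp only: sum.distrib sum_mset.distrib sum_mset_sum_swap distrib_left add_ac)
    also have "\<dots> = q * m * pot d (Suc b) M
        + x * ((\<Sum>j\<le>b. pot d j (add_mset (b - j) M))
             + (\<Sum>c\<in>#M. of_nat c * pot (d + 2) (b + c) (M - {#c#})))"
      using 3 by (simp add: pot_def pair_sum_add_mset)
    finally show ?thesis using 3 by simp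
  next
    \<comment> \<open>Both sides are 0. Since \<open>d \<ge> 0\<close>, the value
      \<open>d + 2\<close> cannot reach 0, and 2 and 4 would need \<open>d\<close> to be 0 or
      2.\<close>
    case 4
    then show ?thesis using assms by (simp add: pot_def)
  qed
qed

end

section \<open>Inserting an element into a permutation\<close>

definition is_cycle :: "('a \<Rightarrow> 'a) \<Rightarrow> 'a list \<Rightarrow> bool" where
  "is_cycle f L \<longleftrightarrow> L \<noteq> [] \<and> distinct L \<and> map f L = rotate1 L"

lemma is_cycle_Cons: "is_cycle f (a # xs) \<longleftrightarrow> distinct (a # xs) \<and> map f (a # xs) = xs @ [a]"
  by (simp add: is_cycle_def)

lemma is_cycle_orbit:
  assumes "is_cycle f L" "a \<in> set L"
  shows "orbit f a = set L"
proof -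
  let ?n = "length L"
  have n: "?n > 0" using assms by (auto simp: is_cycle_def)
  obtain i where i: "i < ?n" "a = L ! i" using assms(2) by (auto simp: in_set_conv_nth)
  have step: "f (L ! k) = L ! (Suc k mod ?n)" if "k < ?n" for k
  proof -
    have "map f L ! k = rotate1 L ! k" using assms(1) by (simp only: is_cycle_def)
    then show ?thesis using that by (simp add: nth_rotate1)
  qed
  have pow: "(f ^^ t) a = L ! ((i + t) mod ?n)" for t
  proof (induction t)
    case (Suc t)
    then show ?case using n by (simp add: step mod_Suc_eq)
  qed (use i in simp)
  show ?thesis
  proof
    show "orbit f a \<subseteq> set L" using n by (auto simp: orbit_altdef pow)
  next
    show "set L \<subseteq> orbit f a"
    proof
      fix y assume "y \<in> set L"
      then obtain j where j: "j < ?n" "y = L ! j" by (auto simp: in_set_conv_nth)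
      \<comment> \<open>Adding the length keeps the exponent positive, as \<open>orbit\<close> is
        described by positive powers.\<close>
      have "(f ^^ (j + ?n - i)) a = y" using i(1) j pow[of "j + ?n - i"] by simp
      moreover have "j + ?n - i > 0" using i by simp
      ultimately show "y \<in> orbit f a" unfolding orbit_altdef by blast
    qed
  qed
qed

lemma ex_is_cycle:
  assumes "permutation f"
  shows "\<exists>xs. is_cycle f (a # xs)"
proof -
  let ?l = "least_power f a"
  have l: "?l > 0" and fl: "(f ^^ ?l) a = a" using least_power_of_permutation[OF assms] by auto
  have "map f (support f a) = rotate1 (support f a)"
  proof (rule nth_equalityI)
    fix i assume "i < length (map f (support f a))"
    then have i: "i < ?l" by simp
    have "f ((f ^^ i) a) = (f ^^ (Suc i mod ?l)) a"
    proof (cases "Suc i = ?l")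
      case True
      then have "f ((f ^^ i) a) = (f ^^ ?l) a" by (metis comp_apply funpow.simps(2))
      then show ?thesis using True fl by simp
    qed (use i in simp)
    then show "map f (support f a) ! i = rotate1 (support f a) ! i"
      using i l by (simp add: nth_rotate1)
  qed simp
  then have "is_cycle f (support f a)"
    using l cycle_of_permutation[OF assms] by (auto simp: is_cycle_def)
  moreover have "support f a = a # map (\<lambda>i. (f ^^ i) a) [1..<?l]"
    using l by (simp add: upt_conv_Cons)
  ultimately show ?thesis by metis
qed

text \<open>The composite sends \<open>a\<close> to \<open>e\<close> and \<open>e\<close> to
  \<open>f a\<close>; listed from \<open>e\<close>, the new cycle ends in \<open>a\<close>.\<close>

lemma is_cycle_insert:
  assumes "is_cycle f (a # xs)" "f e = e" "e \<notin> set (a # xs)"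
  shows "is_cycle (f \<circ> transpose a e) (e # xs @ [a])"
proof -
  have d: "distinct (a # xs)" and m: "map f (a # xs) = xs @ [a]"
    using assms(1) by (auto simp: is_cycle_Cons)
  have mm: "map (f \<circ> transpose a e) xs = map f xs"
    using d assms(3) by (intro map_cong) (auto simp: transpose_def)
  have "map (f \<circ> transpose a e) (e # xs @ [a]) = map f (a # xs) @ [e]"
    by (simp add: mm assms(2))
  then have "map (f \<circ> transpose a e) (e # xs @ [a]) = (xs @ [a]) @ [e]" unfolding m .
  moreover have "distinct (e # xs @ [a])" using d assms(3) by auto
  ultimately show ?thesis unfolding is_cycle_Cons by blast
qed

text \<open>The arrows into \<open>v\<close> and into \<open>e\<close> exchange their targets, so
  the path through \<open>A\<close> returns to \<open>e\<close> and the path through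
  \<open>B\<close> to \<open>v\<close>.\<close>

lemma is_cycle_split:
  assumes "is_cycle f (e # A @ v # B)"
  shows "is_cycle (transpose v e \<circ> f) (e # A)" "is_cycle (transpose v e \<circ> f) (v # B)"
proof -
  have d: "distinct (e # A @ v # B)" and m: "map f (e # A) @ map f (v # B) = (A @ [v]) @ (B @ [e])"
    using assms by (auto simp: is_cycle_Cons)
  have "map f (e # A) = A @ [v] \<and> map f (v # B) = B @ [e]"
    using m by (subst (asm) append_eq_append_conv) simp_all
  then have m': "map f (e # A) = A @ [v]" "map f (v # B) = B @ [e]" by blast+
  have [simp]: "map (transpose v e) A = A" "map (transpose v e) B = B"
    using d by (auto intro!: map_idI simp: transpose_def)
  have "map (transpose v e \<circ> f) (e # A) = A @ [e]" "map (transpose v e \<circ> f) (v # B) = B @ [v]"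
    unfolding map_map[symmetric] m' by simp_all
  then show "is_cycle (transpose v e \<circ> f) (e # A)" "is_cycle (transpose v e \<circ> f) (v # B)"
    using d by (auto simp: is_cycle_Cons)
qed

text \<open>The same exchange of targets, now applied to arrows on two cycles.\<close>

lemma is_cycle_join:
  assumes "is_cycle f (e # A)" "is_cycle f (v # B)" "set (e # A) \<inter> set (v # B) = {}"
  shows "is_cycle (transpose v e \<circ> f) (e # A @ v # B)"
proof -
  have d: "distinct (e # A @ v # B)" using assms by (auto simp: is_cycle_Cons)
  have m: "map f (e # A) = A @ [e]" "map f (v # B) = B @ [v]"
    using assms by (auto simp: is_cycle_Cons)
  have [simp]: "map (transpose v e) A = A" "map (transpose v e) B = B"
    using d by (auto intro!: map_idI simp: transpose_def)
  have "map (transpose v e \<circ> f) (e # A) = A @ [v]" "map (transpose v e \<circ> f) (v # B) = B @ [e]"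
    unfolding map_map[symmetric] m by simp_all
  then show ?thesis using d by (auto simp: is_cycle_Cons)
qed

section \<open>Orbits away from the modified cycle\<close>

lemma orbit_image_cong:
  assumes f: "f permutes S" and S: "finite S" and C: "C \<subseteq> S" "f ` C \<subseteq> C"
    and eq: "\<And>x. x \<in> S - C \<Longrightarrow> g x = f x"
  shows "orbit g ` (S - C) = orbit f ` (S - C)"
proof (rule image_cong[OF refl])
  fix x assume x: "x \<in> S - C"
  \<comment> \<open>An injective self-map of a finite set is onto; hence the complement of
    \<open>C\<close> is invariant as well.\<close>
  have "f ` C = C"
    using C S f by (intro endo_inj_surj) (auto intro: finite_subset permutes_inj_on inj_on_subset)
  then have "f \<in> (S - C) \<rightarrow> (S - C)"
    using f C by (auto simp: permutes_in_image) (metis DiffI f image_iff permutes_inj injD subsetD)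
  then show "orbit g x = orbit f x"
    using x eq by (intro orbit_cong0[symmetric, of x "S - C"]) auto
qed

lemma orbit_eq_of_mem:
  assumes "permutation f" "y \<in> orbit f x"
  shows "orbit f y = orbit f x"
  using cyclic_on_orbit'[OF assms(1)] assms(2) by (rule orbit_cyclic_eq3)

lemma card_orbits:
  assumes "f permutes S" "finite S" "a \<in> S"
  shows "card (orbit f ` S) = Suc (card (orbit f ` (S - orbit f a)))"
proof -
  have p: "permutation f" using assms by (auto simp: permutation_permutes)
  have "orbit f ` S = insert (orbit f a) (orbit f ` (S - orbit f a))"
    using assms(3) orbit_eq_of_mem[OF p] by auto
  moreover have "orbit f a \<notin> orbit f ` (S - orbit f a)"
    using permutation_self_in_orbit[OF p] by auto
  ultimately show ?thesis using assms(2) by simp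
qed

text \<open>The sizes count elements of \<open>W\<close>, the block maxima in the application; \<open>cur_size\<close> omits \<open>a\<close>.\<close>

definition cur_size :: "('a \<Rightarrow> 'a) \<Rightarrow> 'a set \<Rightarrow> 'a \<Rightarrow> nat" where
  "cur_size \<beta> W a = card (orbit \<beta> a \<inter> W) - 1"

definition other_sizes :: "('a \<Rightarrow> 'a) \<Rightarrow> 'a set \<Rightarrow> 'a set \<Rightarrow> 'a \<Rightarrow> nat multiset" where
  "other_sizes \<beta> W S a = image_mset (\<lambda>C. card (C \<inter> W)) (mset_set (orbit \<beta> ` (S - orbit \<beta> a)))"

text \<open>The number of elements of \<open>W\<close> before \<open>M\<close> is the rank of
  \<open>M\<close> among the entries in \<open>W\<close>, and each rank occurs once.\<close>

lemma sum_takeWhile: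
  assumes "distinct ys"
  shows "(\<Sum>M\<in>set ys \<inter> W. F (card (set (takeWhile (\<lambda>z. z \<noteq> M) ys) \<inter> W)))
       = (\<Sum>j<card (set ys \<inter> W). (F j :: 'b::comm_monoid_add))"
  using assms
proof (induction ys rule: rev_induct)
  case (snoc y ys)
  have tw: "takeWhile (\<lambda>z. z \<noteq> M) (ys @ [y]) = takeWhile (\<lambda>z. z \<noteq> M) ys" if "M \<in> set ys" for M
    by (rule takeWhile_append1[OF that]) simp
  have "(\<Sum>M\<in>set ys \<inter> W. F (card (set (takeWhile (\<lambda>z. z \<noteq> M) (ys @ [y])) \<inter> W)))
      = (\<Sum>M\<in>set ys \<inter> W. F (card (set (takeWhile (\<lambda>z. z \<noteq> M) ys) \<inter> W)))"
    by (intro sum.cong refl) (simp add: tw)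
  also have "\<dots> = (\<Sum>j<card (set ys \<inter> W). F j)"
    using snoc.prems by (intro snoc.IH) simp
  finally have "(\<Sum>M\<in>set ys \<inter> W. F (card (set (takeWhile (\<lambda>z. z \<noteq> M) (ys @ [y])) \<inter> W)))
      = (\<Sum>j<card (set ys \<inter> W). F j)" .
  moreover have "takeWhile (\<lambda>z. z \<noteq> y) (ys @ [y]) = ys"
    using snoc.prems by (auto simp: takeWhile_append takeWhile_eq_all_conv)
  ultimately show ?case
    using snoc.prems by (cases "y \<in> W") (simp_all add: Int_insert_left add.commute)
qed simp

section \<open>Effect of one insertion on the cycles and their sizes\<close>

context
  fixes \<beta> :: "'a \<Rightarrow> 'a" and S W :: "'a set" and a e :: 'a
  assumes \<beta>: "\<beta> permutes S" and S: "finite S" and W: "W \<subseteq> S" and a: "a \<in> W" and e: "e \<notin> S"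
begin

lemma orbit_subset_carrier: "x \<in> S \<Longrightarrow> orbit \<beta> x \<subseteq> S"
  using \<beta> by (rule permutes_orbit_subset)

lemma permutation_\<beta>: "permutation \<beta>"
  using \<beta> S by (auto simp: permutation_permutes)

lemma self_orbit: "x \<in> orbit \<beta> x"
  by (rule permutation_self_in_orbit[OF permutation_\<beta>])

lemma orbit_eq: "y \<in> orbit \<beta> x \<Longrightarrow> orbit \<beta> y = orbit \<beta> x"
  by (rule orbit_eq_of_mem[OF permutation_\<beta>])

lemma is_cycle_at:
  assumes "v \<in> S"
  obtains xs where "is_cycle \<beta> (v # xs)" "orbit \<beta> v = set (v # xs)" "set (v # xs) \<subseteq> S"
proof -
  obtain xs where xs: "is_cycle \<beta> (v # xs)" using ex_is_cycle[OF permutation_\<beta>] by metis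
  have "orbit \<beta> v = set (v # xs)" by (rule is_cycle_orbit[OF xs]) simp
  then show ?thesis using that[OF xs] orbit_subset_carrier[OF assms] by simp
qed

lemma permutes_insert_cycle: "\<beta> \<circ> transpose a e permutes insert e S"
  using \<beta> W a by (intro permutes_compose) (auto intro: permutes_subset permutes_swap_id)

lemma fix_new: "\<beta> e = e"
  using \<beta> e by (simp add: permutes_not_in)

lemma new_orbit: "orbit (\<beta> \<circ> transpose a e) e = insert e (orbit \<beta> a)"
proof -
  obtain xs where xs: "is_cycle \<beta> (a # xs)" "orbit \<beta> a = set (a # xs)" "set (a # xs) \<subseteq> S"
    using is_cycle_at[of a] W a by blast
  have "e \<notin> set (a # xs)" using xs(3) e by blast
  then have "is_cycle (\<beta> \<circ> transpose a e) (e # xs @ [a])"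
    using is_cycle_insert[OF xs(1) fix_new] by blast
  from is_cycle_orbit[OF this, of e] xs(2) show ?thesis by auto
qed

lemma other_orbits:
  "orbit (\<beta> \<circ> transpose a e) ` (insert e S - insert e (orbit \<beta> a)) = orbit \<beta> ` (S - orbit \<beta> a)"
proof -
  have "insert e S - insert e (orbit \<beta> a) = S - orbit \<beta> a" using e by auto
  moreover have "orbit (\<beta> \<circ> transpose a e) ` (S - orbit \<beta> a) = orbit \<beta> ` (S - orbit \<beta> a)"
  proof (rule orbit_image_cong[OF \<beta> S])
    show "orbit \<beta> a \<subseteq> S" using orbit_subset_carrier W a by blast
    show "\<beta> ` orbit \<beta> a \<subseteq> orbit \<beta> a" by (auto intro: orbit.intros)
    show "(\<beta> \<circ> transpose a e) x = \<beta> x" if "x \<in> S - orbit \<beta> a" for x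
      using that e self_orbit[of a] by (auto simp: transpose_def)
  qed
  ultimately show ?thesis by simp
qed

abbreviation (input) "\<beta>\<^sub>1 \<equiv> \<beta> \<circ> transpose a e"
abbreviation (input) "other_cycles \<equiv> orbit \<beta> ` (S - orbit \<beta> a)"

lemma other_cycles_disjoint: "C \<in> other_cycles \<Longrightarrow> C \<subseteq> S - orbit \<beta> a"
proof -
  assume "C \<in> other_cycles"
  then obtain x where x: "x \<in> S" "x \<notin> orbit \<beta> a" "C = orbit \<beta> x" by blast
  have "y \<notin> orbit \<beta> a" if "y \<in> C" for y
    using that x orbit_eq[of y x] orbit_eq[of y a] self_orbit[of x] by auto
  then show ?thesis using x orbit_subset_carrier by blast
qed

lemma finite_other_cycles: "finite other_cycles" using S by simp

lemma cur_size_Suc: "card (orbit \<beta> a \<inter> W) = Suc (cur_size \<beta> W a)"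
proof -
  have "finite (orbit \<beta> a \<inter> W)" using W S finite_subset by blast
  moreover have "orbit \<beta> a \<inter> W \<noteq> {}" using self_orbit[of a] a by blast
  ultimately show ?thesis by (simp add: cur_size_def card_gt_0_iff)
qed

text \<open>The moves are later applied with \<open>S\<close> = {1..n}, \<open>W\<close> the block
  maxima, \<open>a\<close> = n and \<open>e\<close> = n + 1. Here \<open>e\<close> is one more
  maximum on the cycle of \<open>a\<close>.\<close>

lemma new_block:
  "cur_size \<beta>\<^sub>1 (insert e W) e = Suc (cur_size \<beta> W a)"
  "other_sizes \<beta>\<^sub>1 (insert e W) (insert e S) e = other_sizes \<beta> W S a"
proof -
  have "insert e (orbit \<beta> a) \<inter> insert e W = insert e (orbit \<beta> a \<inter> W)" by auto
  moreover have "e \<notin> orbit \<beta> a \<inter> W" "finite (orbit \<beta> a \<inter> W)"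
    using e W S by (auto intro: finite_subset)
  ultimately show "cur_size \<beta>\<^sub>1 (insert e W) e = Suc (cur_size \<beta> W a)"
    using cur_size_Suc by (simp add: cur_size_def new_orbit)
  have "C \<inter> insert e W = C \<inter> W" if "C \<in> other_cycles" for C
    using other_cycles_disjoint[OF that] e by auto
  then show "other_sizes \<beta>\<^sub>1 (insert e W) (insert e S) e = other_sizes \<beta> W S a"
    unfolding other_sizes_def new_orbit other_orbits
    by (intro image_mset_cong) (use finite_other_cycles in simp)
qed

lemma new_cycle:
  obtains ys where "is_cycle \<beta>\<^sub>1 (e # ys)" "set ys = orbit \<beta> a" "distinct ys"
proof -
  obtain xs where xs: "is_cycle \<beta> (a # xs)" "orbit \<beta> a = set (a # xs)" "set (a # xs) \<subseteq> S"
    using is_cycle_at[of a] W a by blast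
  have "e \<notin> set (a # xs)" using xs(3) e by blast
  then have "is_cycle \<beta>\<^sub>1 (e # xs @ [a])"
    using is_cycle_insert[OF xs(1) fix_new] by blast
  then show ?thesis using that[of "xs @ [a]"] xs(2) by (auto simp: is_cycle_def)
qed

text \<open>The cycle e A M B falls apart into e A and M B. As \<open>e\<close> replaces
  \<open>M\<close> in \<open>W\<close>, the first part has the \<open>j\<close> maxima in
  \<open>A\<close> besides \<open>e\<close>, the second only those in \<open>B\<close>.\<close>

lemma split_block:
  assumes cyc: "is_cycle \<beta>\<^sub>1 (e # ys)" and ys: "set ys = orbit \<beta> a"
    and M: "M \<in> orbit \<beta> a" "M \<in> W"
  defines "\<beta>' \<equiv> transpose M e \<circ> \<beta>\<^sub>1" and "W' \<equiv> insert e (W - {M})"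
    and "j \<equiv> card (set (takeWhile (\<lambda>z. z \<noteq> M) ys) \<inter> W)"
  shows "cur_size \<beta>' W' e = j"
    "other_sizes \<beta>' W' (insert e S) e = add_mset (cur_size \<beta> W a - j) (other_sizes \<beta> W S a)"
proof -
  define A where "A = takeWhile (\<lambda>z. z \<noteq> M) ys"
  obtain C B where CB: "ys = C @ M # B" "M \<notin> set C"
    using M(1) ys split_list_first[of M ys] by blast
  from CB(2) have "A = C" unfolding A_def CB(1) by (subst takeWhile_append2) auto
  with CB(1) have AB: "ys = A @ M # B" by simp
  have d: "distinct (e # A @ M # B)" using cyc AB by (auto simp: is_cycle_def)
  have cycs: "is_cycle \<beta>' (e # A)" "is_cycle \<beta>' (M # B)"
    unfolding \<beta>'_def by (rule is_cycle_split[OF cyc[unfolded AB]])+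
  have oe: "orbit \<beta>' e = insert e (set A)" using is_cycle_orbit[OF cycs(1)] by simp
  have fin: "finite W" using W S finite_subset by blast
  have sub: "orbit \<beta> a \<subseteq> S" using orbit_subset_carrier W a by blast
  have "insert e (set A) \<inter> W' = insert e (set A \<inter> W)" using d by (auto simp: W'_def)
  then show "cur_size \<beta>' W' e = j"
    using fin d by (simp add: cur_size_def oe j_def A_def[symmetric])
  have "orbit \<beta> a \<inter> W = insert M ((set A \<inter> W) \<union> (set B \<inter> W))"
    using M ys AB by auto
  moreover have "card (insert M ((set A \<inter> W) \<union> (set B \<inter> W))) = Suc (card (set A \<inter> W) + card (set B \<inter> W))"
    using d fin by (subst card_insert_disjoint) (auto intro!: card_Un_disjoint)
  ultimately have cB: "card (set B \<inter> W) = cur_size \<beta> W a - j"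
    using cur_size_Suc by (simp add: j_def A_def[symmetric])
  have "insert e S - insert e (set A) = set (M # B) \<union> (insert e S - insert e (orbit \<beta> a))"
    using ys AB d sub e by auto
  then have "orbit \<beta>' ` (insert e S - orbit \<beta>' e)
      = orbit \<beta>' ` set (M # B) \<union> orbit \<beta>' ` (insert e S - insert e (orbit \<beta> a))"
    unfolding oe by (simp only: image_Un)
  also have "orbit \<beta>' ` set (M # B) = {set (M # B)}"
    using is_cycle_orbit[OF cycs(2)] by auto
  \<comment> \<open>Outside the cycle of \<open>e\<close> the values of
    \<open>\<beta>\<^sub>1\<close> differ from \<open>M\<close> and \<open>e\<close>, so the
    transposition on the left has no effect there.\<close>
  also have "orbit \<beta>' ` (insert e S - insert e (orbit \<beta> a))
      = orbit \<beta>\<^sub>1 ` (insert e S - insert e (orbit \<beta> a))"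
  proof (rule orbit_image_cong[OF permutes_insert_cycle])
    show "\<beta>\<^sub>1 ` insert e (orbit \<beta> a) \<subseteq> insert e (orbit \<beta> a)"
      unfolding new_orbit[symmetric] using orbit.step[of _ \<beta>\<^sub>1 e] by blast
    fix x assume x: "x \<in> insert e S - insert e (orbit \<beta> a)"
    then have "\<beta>\<^sub>1 x \<notin> insert e (orbit \<beta> a)"
      using permutes_insert_cycle S unfolding new_orbit[symmetric]
      by (metis DiffD2 cyclic_on_f_in cyclic_on_orbit finite.insertI)
    then show "\<beta>' x = \<beta>\<^sub>1 x" using M by (auto simp: \<beta>'_def transpose_def)
  qed (use S sub in auto)
  also note other_orbits
  finally have o: "orbit \<beta>' ` (insert e S - orbit \<beta>' e) = insert (set (M # B)) other_cycles" by simp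
  have "set (M # B) \<notin> other_cycles" using other_cycles_disjoint M(1) by fastforce
  moreover have "card (set (M # B) \<inter> W') = card (set B \<inter> W)"
    using d by (intro arg_cong[where f = card]) (auto simp: W'_def)
  moreover have "C \<inter> W' = C \<inter> W" if "C \<in> other_cycles" for C
    using other_cycles_disjoint[OF that] e M(1) by (auto simp: W'_def)
  then have "image_mset (\<lambda>C. card (C \<inter> W')) (mset_set other_cycles) = other_sizes \<beta> W S a"
    unfolding other_sizes_def by (intro image_mset_cong) (use finite_other_cycles in simp)
  ultimately show "other_sizes \<beta>' W' (insert e S) e
      = add_mset (cur_size \<beta> W a - j) (other_sizes \<beta> W S a)"
    unfolding other_sizes_def[of \<beta>'] o using finite_other_cycles cB by simp
qed

text \<open>The joined cycle meets the new \<open>W\<close> in the maxima of the cycle of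
  \<open>a\<close>, those of \<open>C\<close> other than \<open>M\<close>, and \<open>e\<close>,
  which \<open>cur_size\<close> leaves out.\<close>

lemma join_block:
  assumes C: "C \<in> other_cycles" and M: "M \<in> C" "M \<in> W"
  defines "\<beta>' \<equiv> transpose M e \<circ> \<beta>\<^sub>1" and "W' \<equiv> insert e (W - {M})"
  shows "cur_size \<beta>' W' e = cur_size \<beta> W a + card (C \<inter> W)"
    "other_sizes \<beta>' W' (insert e S) e = other_sizes \<beta> W S a - {#card (C \<inter> W)#}"
proof -
  obtain ys where cyc: "is_cycle \<beta>\<^sub>1 (e # ys)" and ys: "set ys = orbit \<beta> a" by (rule new_cycle)
  have dC: "C \<subseteq> S - orbit \<beta> a" by (rule other_cycles_disjoint[OF C])
  then have MS: "M \<in> S" "M \<noteq> e" using M e by auto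
  obtain B where B: "is_cycle \<beta> (M # B)" "orbit \<beta> M = set (M # B)" using is_cycle_at[OF MS(1)] by metis
  have CB: "C = set (M # B)" using C M(1) B(2) orbit_eq by auto
  have "a \<notin> C" "e \<notin> C" using dC self_orbit[of a] e by auto
  then have "map \<beta>\<^sub>1 (M # B) = map \<beta> (M # B)" unfolding CB by (intro map_cong) (auto simp: transpose_def)
  with B(1) have B1: "is_cycle \<beta>\<^sub>1 (M # B)" unfolding is_cycle_def by metis
  have "set (e # ys) \<inter> set (M # B) = {}" using dC \<open>e \<notin> C\<close> ys unfolding CB[symmetric] by auto
  from is_cycle_join[OF cyc B1 this] have cyc': "is_cycle \<beta>' (e # ys @ M # B)" by (simp add: \<beta>'_def)
  have oe: "orbit \<beta>' e = insert e (orbit \<beta> a \<union> C)"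
    using is_cycle_orbit[OF cyc', of e] ys CB by auto
  have fin: "finite W" using W S finite_subset by blast
  have sub: "orbit \<beta> a \<subseteq> S" using orbit_subset_carrier W a by blast
  have "orbit \<beta>' e \<inter> W' = insert e ((orbit \<beta> a \<inter> W) \<union> (C \<inter> W - {M}))"
    unfolding oe using dC M(1) by (auto simp: W'_def)
  moreover have "card (insert e ((orbit \<beta> a \<inter> W) \<union> (C \<inter> W - {M})))
      = Suc (card (orbit \<beta> a \<inter> W) + card (C \<inter> W - {M}))"
    using fin e W dC by (subst card_insert_disjoint) (auto intro!: card_Un_disjoint)
  moreover have "card (C \<inter> W) = Suc (card (C \<inter> W - {M}))"
    using M fin by (intro card.remove) auto
  ultimately show "cur_size \<beta>' W' e = cur_size \<beta> W a + card (C \<inter> W)"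
    using cur_size_Suc by (simp add: cur_size_def[of \<beta>'])
  let ?D = "orbit \<beta> a \<union> C"
  have "orbit \<beta>' ` (S - ?D) = orbit \<beta> ` (S - ?D)"
  proof (rule orbit_image_cong[OF \<beta> S])
    show closed: "\<beta> ` ?D \<subseteq> ?D"
      using C by (auto intro: orbit.intros)
    show "?D \<subseteq> S" using sub dC by auto
    fix x assume x: "x \<in> S - ?D"
    then have "x \<noteq> a" "x \<noteq> e" using self_orbit[of a] e by auto
    moreover have "\<beta> x \<noteq> M"
    proof
      assume "\<beta> x = M"
      then have "M \<in> orbit \<beta> x" by (metis orbit.base)
      then have "x \<in> orbit \<beta> M" using orbit_eq[of M x] self_orbit[of x] by simp
      then show False using x B(2) CB by auto
    qed
    moreover have "\<beta> x \<noteq> e" using x \<beta> e by (metis DiffD1 permutes_in_image)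
    ultimately show "\<beta>' x = \<beta> x" by (simp add: \<beta>'_def transpose_def)
  qed
  moreover have "insert e S - orbit \<beta>' e = S - ?D" unfolding oe using e by auto
  moreover have "orbit \<beta> ` (S - ?D) = other_cycles - {C}"
  proof -
    have "orbit \<beta> x = C \<longleftrightarrow> x \<in> C" if "x \<in> S" for x
      using C orbit_eq self_orbit by auto
    then show ?thesis by auto
  qed
  ultimately have o: "orbit \<beta>' ` (insert e S - orbit \<beta>' e) = other_cycles - {C}" by simp
  have "D \<inter> W' = D \<inter> W" if "D \<in> other_cycles - {C}" for D
  proof -
    have "D' = orbit \<beta> M" if "D' \<in> other_cycles" "M \<in> D'" for D'
      using that orbit_eq[of M] by auto
    then have "M \<notin> D" using that M(1) C by blast
    moreover have "e \<notin> D" using that other_cycles_disjoint[of D] e by auto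
    ultimately show ?thesis by (auto simp: W'_def)
  qed
  then have "other_sizes \<beta>' W' (insert e S) e = image_mset (\<lambda>D. card (D \<inter> W)) (mset_set (other_cycles - {C}))"
    unfolding other_sizes_def o by (intro image_mset_cong) (use finite_other_cycles in simp)
  moreover have "mset_set other_cycles = add_mset C (mset_set (other_cycles - {C}))"
    using finite_other_cycles C by (rule mset_set.remove)
  ultimately show "other_sizes \<beta>' W' (insert e S) e = other_sizes \<beta> W S a - {#card (C \<inter> W)#}"
    by (simp add: other_sizes_def[of \<beta>])
qed

text \<open>Serves to show that the genus does not decrease.\<close>

lemma size_insert_block:
  assumes M: "M \<in> W"
  shows "size (other_sizes (transpose M e \<circ> \<beta>\<^sub>1) (insert e (W - {M})) (insert e S) e)
    \<le> Suc (size (other_sizes \<beta> W S a))"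
proof (cases "M \<in> orbit \<beta> a")
  case True
  obtain ys where "is_cycle \<beta>\<^sub>1 (e # ys)" "set ys = orbit \<beta> a" by (rule new_cycle)
  from split_block(2)[OF this True M] show ?thesis by simp
next
  case False
  then have "orbit \<beta> M \<in> other_cycles" using M W by blast
  from join_block(2)[OF this self_orbit M] show ?thesis
    by (metis diff_subset_eq_self le_SucI size_mset_mono)
qed

text \<open>\<open>W\<close> is divided among the cycles of \<open>\<beta>\<close>. On the cycle of
  \<open>a\<close> each \<open>j \<le> b\<close> arises from exactly one \<open>M\<close>; any other
  cycle with \<open>c\<close> maxima gives \<open>c\<close> equal terms.\<close>

lemma sum_insert_block:
  fixes H :: "nat \<Rightarrow> nat multiset \<Rightarrow> 'c::comm_semiring_1"
  defines "b \<equiv> cur_size \<beta> W a" and "N \<equiv> other_sizes \<beta> W S a"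
  shows "(\<Sum>M\<in>W. let \<beta>' = transpose M e \<circ> \<beta>\<^sub>1; W' = insert e (W - {M})
                in H (cur_size \<beta>' W' e) (other_sizes \<beta>' W' (insert e S) e))
     = (\<Sum>j\<le>b. H j (add_mset (b - j) N)) + (\<Sum>c\<in>#N. of_nat c * H (b + c) (N - {#c#}))"
    (is "sum ?F W = _")
proof -
  obtain ys where cyc: "is_cycle \<beta>\<^sub>1 (e # ys)" and ys: "set ys = orbit \<beta> a" "distinct ys"
    by (rule new_cycle)
  have fin: "finite W" using W S finite_subset by blast
  have W_eq: "W = (orbit \<beta> a \<inter> W) \<union> (\<Union>C\<in>other_cycles. C \<inter> W)"
    using W self_orbit by auto
  have "sum ?F W = sum ?F (orbit \<beta> a \<inter> W) + sum ?F (\<Union>C\<in>other_cycles. C \<inter> W)"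
    using fin finite_other_cycles other_cycles_disjoint by (subst W_eq, intro sum.union_disjoint) auto
  also have "sum ?F (orbit \<beta> a \<inter> W)
      = (\<Sum>M\<in>set ys \<inter> W. (\<lambda>j. H j (add_mset (b - j) N)) (card (set (takeWhile (\<lambda>z. z \<noteq> M) ys) \<inter> W)))"
    unfolding ys(1)[symmetric]
    by (intro sum.cong refl) (simp add: split_block[OF cyc ys(1)] ys(1) b_def N_def Let_def)
  also have "\<dots> = (\<Sum>j\<le>b. H j (add_mset (b - j) N))"
    using sum_takeWhile[OF ys(2), of "\<lambda>j. H j (add_mset (b - j) N)" W]
    by (simp add: ys(1) cur_size_Suc b_def lessThan_Suc_atMost)
  also have "sum ?F (\<Union>C\<in>other_cycles. C \<inter> W) = (\<Sum>C\<in>other_cycles. sum ?F (C \<inter> W))"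
  proof (rule sum.UNION_disjoint)
    show "\<forall>C\<in>other_cycles. \<forall>D\<in>other_cycles. C \<noteq> D \<longrightarrow> (C \<inter> W) \<inter> (D \<inter> W) = {}"
      using orbit_eq by blast
  qed (use fin finite_other_cycles in auto)
  also have "\<dots> = (\<Sum>C\<in>other_cycles. of_nat (card (C \<inter> W)) * H (b + card (C \<inter> W)) (N - {#card (C \<inter> W)#}))"
  proof (rule sum.cong[OF refl])
    fix C assume C: "C \<in> other_cycles"
    have "sum ?F (C \<inter> W) = (\<Sum>M\<in>C \<inter> W. H (b + card (C \<inter> W)) (N - {#card (C \<inter> W)#}))"
      by (intro sum.cong refl) (simp add: join_block[OF C] b_def N_def Let_def)
    then show "sum ?F (C \<inter> W) = of_nat (card (C \<inter> W)) * H (b + card (C \<inter> W)) (N - {#card (C \<inter> W)#})"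
      by simp
  qed
  also have "\<dots> = (\<Sum>c\<in>#N. of_nat c * H (b + c) (N - {#c#}))"
    unfolding N_def other_sizes_def by (simp add: sum_unfold_sum_mset image_mset.compositionality comp_def)
  finally show ?thesis .
qed

end

section \<open>Partitions and their extensions\<close>

text \<open>The non-ascents. Every cycle has one, its maximum; for a partition there are no others,
  so these are the block maxima.\<close>

definition block_tops :: "nat \<Rightarrow> (nat \<Rightarrow> nat) \<Rightarrow> nat set" where
  "block_tops n \<alpha> = {i \<in> {1..n}. \<alpha> i \<le> i}"

lemma finite_block_tops [simp]: "finite (block_tops n \<alpha>)"
  by (simp add: block_tops_def)

context
  fixes n :: nat and \<alpha> :: "nat \<Rightarrow> nat"
  assumes \<alpha>: "\<alpha> permutes {1..n}"
begin

lemma permutation_\<alpha>: "permutation \<alpha>"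
  using \<alpha> by (auto simp: permutation_permutes)

lemma cycle_sets_props:
  assumes "C \<in> cycle_sets n \<alpha>"
  shows "finite C" "C \<noteq> {}" "C \<subseteq> {1..n}" "i \<in> C \<Longrightarrow> \<alpha> i \<in> C" "i \<in> C \<Longrightarrow> orbit \<alpha> i = C"
proof -
  obtain j where j: "j \<in> {1..n}" "C = orbit \<alpha> j" using assms by (auto simp: cycle_sets_def)
  show sub: "C \<subseteq> {1..n}" using permutes_orbit_subset[OF \<alpha>] j by blast
  then show "finite C" by (rule finite_subset) simp
  show "C \<noteq> {}" unfolding j(2) by (rule orbit_nonempty)
  show "i \<in> C \<Longrightarrow> \<alpha> i \<in> C" unfolding j(2) by (rule orbit.step)
  show "i \<in> C \<Longrightarrow> orbit \<alpha> i = C" unfolding j(2) by (rule orbit_eq_of_mem[OF permutation_\<alpha>])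
qed

lemma Max_cycle_sets: "Max ` cycle_sets n \<alpha> \<subseteq> block_tops n \<alpha>"
proof safe
  fix C assume C: "C \<in> cycle_sets n \<alpha>"
  have "Max C \<in> C" using cycle_sets_props[OF C] by simp
  moreover from this have "\<alpha> (Max C) \<le> Max C" using cycle_sets_props[OF C] by simp
  ultimately show "Max C \<in> block_tops n \<alpha>"
    using cycle_sets_props(3)[OF C] unfolding block_tops_def by blast
qed

lemma inj_Max_cycle_sets: "inj_on Max (cycle_sets n \<alpha>)"
proof (rule inj_onI)
  fix C D assume CD: "C \<in> cycle_sets n \<alpha>" "D \<in> cycle_sets n \<alpha>" "Max C = Max D"
  have "Max C \<in> C" "Max D \<in> D" using cycle_sets_props CD(1,2) by (simp_all add: Max_in)
  then show "C = D" using CD cycle_sets_props(5) by metis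
qed

lemma num_cycles_le: "num_cycles n \<alpha> \<le> card (block_tops n \<alpha>)"
  unfolding num_cycles_def using card_mono[OF _ Max_cycle_sets] card_image[OF inj_Max_cycle_sets]
  by simp

lemma num_cycles_eq_iff:
  "num_cycles n \<alpha> = card (block_tops n \<alpha>) \<longleftrightarrow> Max ` cycle_sets n \<alpha> = block_tops n \<alpha>"
  unfolding num_cycles_def
  using card_subset_eq[OF _ Max_cycle_sets] card_image[OF inj_Max_cycle_sets] by fastforce

lemma set_support: "set (support \<alpha> i) = orbit \<alpha> i"
  unfolding support_set[OF permutation_\<alpha>] orbit_altdef_permutation[OF permutation_\<alpha>] by auto

text \<open>Turns the order condition into a count: equality means that no cycle has a non-ascent
  besides its maximum, that is, it increases until it returns to its minimum.\<close>

lemma sorted_supports_iff: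
  "(\<forall>C\<in>cycle_sets n \<alpha>. sorted_wrt (<) (support \<alpha> (Min C)))
     \<longleftrightarrow> num_cycles n \<alpha> = card (block_tops n \<alpha>)"
proof
  assume *: "\<forall>C\<in>cycle_sets n \<alpha>. sorted_wrt (<) (support \<alpha> (Min C))"
  have "i \<in> Max ` cycle_sets n \<alpha>" if i: "i \<in> block_tops n \<alpha>" for i
  proof -
    define C where "C = orbit \<alpha> i"
    have C: "C \<in> cycle_sets n \<alpha>" using i by (auto simp: C_def cycle_sets_def block_tops_def)
    define L where "L = support \<alpha> (Min C)"
    have sorted: "sorted_wrt (<) L" using * C by (simp add: L_def)
    have LC: "set L = C" unfolding L_def set_support using cycle_sets_props[OF C] by simp
    have iC: "i \<in> C" unfolding C_def by (rule permutation_self_in_orbit[OF permutation_\<alpha>])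
    then obtain j where j: "j < length L" "i = L ! j" using LC by (metis in_set_conv_nth)
    have "\<not> Suc j < length L"
    proof
      assume Sj: "Suc j < length L"
      then have "L ! j < L ! Suc j" using sorted by (simp add: sorted_wrt_nth_less)
      moreover have "L ! Suc j = \<alpha> i" using Sj j by (simp add: L_def)
      ultimately show False using i j by (simp add: block_tops_def)
    qed
    then have "y \<le> i" if "y \<in> C" for y
      using that j sorted unfolding LC[symmetric]
      by (metis Suc_lessI in_set_conv_nth less_or_eq_imp_le linorder_neqE_nat sorted_wrt_nth_less
          Suc_le_eq le_less_trans not_less_eq)
    then have "Max C = i" using iC cycle_sets_props(1)[OF C] by (intro Max_eqI) auto
    then show ?thesis using C by blast
  qed
  then show "num_cycles n \<alpha> = card (block_tops n \<alpha>)"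
    unfolding num_cycles_eq_iff using Max_cycle_sets by blast
next
  assume "num_cycles n \<alpha> = card (block_tops n \<alpha>)"
  then have tops: "Max ` cycle_sets n \<alpha> = block_tops n \<alpha>" by (simp only: num_cycles_eq_iff)
  show "\<forall>C\<in>cycle_sets n \<alpha>. sorted_wrt (<) (support \<alpha> (Min C))"
  proof
    fix C assume C: "C \<in> cycle_sets n \<alpha>"
    note props = cycle_sets_props[OF C]
    define m where "m = Min C"
    have mC: "m \<in> C" using props by (simp add: m_def)
    have top: "u = Max C" if "u \<in> C" "\<not> u < \<alpha> u" for u
    proof -
      have "u \<in> block_tops n \<alpha>" using that props(3) by (auto simp: block_tops_def)
      then obtain D where D: "D \<in> cycle_sets n \<alpha>" "u = Max D" using tops by blast
      then have "u \<in> D" using cycle_sets_props[OF D(1)] by simp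
      then have "D = C" using that(1) props(5) cycle_sets_props(5)[OF D(1)] by blast
      with D show ?thesis by simp
    qed
    have step: "(\<alpha> ^^ j) m < (\<alpha> ^^ Suc j) m" if j: "Suc j < least_power \<alpha> m" for j
    proof (rule ccontr)
      define i where "i = (\<alpha> ^^ j) m"
      assume "\<not> (\<alpha> ^^ j) m < (\<alpha> ^^ Suc j) m"
      then have ni: "\<not> i < \<alpha> i" by (simp add: i_def)
      have iC: "i \<in> C" unfolding i_def using props(4) mC by (induction j) auto
      have i: "i = Max C" by (rule top[OF iC ni])
      \<comment> \<open>The iterates never fall below \<open>\<alpha> i\<close>: every element
        except the maximum \<open>i\<close> ascends, and \<open>i\<close> leads back to
        \<open>\<alpha> i\<close>. Hence \<open>\<alpha> i\<close> is the minimum \<open>m\<close>,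
        and the cycle closes too early.\<close>
      have "(\<alpha> ^^ t) (\<alpha> i) \<in> C \<and> \<alpha> i \<le> (\<alpha> ^^ t) (\<alpha> i)" for t
      proof (induction t)
        case (Suc t)
        let ?u = "(\<alpha> ^^ t) (\<alpha> i)"
        show ?case
        proof (cases "?u = i")
          case False
          then have "?u < \<alpha> ?u" using top[of ?u] i Suc by blast
          then show ?thesis using Suc props(4) by simp
        qed (use iC props(4) in simp)
      qed (use iC props(4) in simp)
      moreover have "m \<in> orbit \<alpha> (\<alpha> i)" using props(4)[OF iC] props(5) mC by simp
      ultimately have "\<alpha> i \<le> m" unfolding orbit_altdef by blast
      moreover have "m \<le> \<alpha> i" unfolding m_def using props(1) props(4)[OF iC] by simp
      ultimately have "(\<alpha> ^^ Suc j) m = m" by (simp add: i_def)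
      then have "least_power \<alpha> m \<le> Suc j" by (intro least_power_le) auto
      then show False using j by simp
    qed
    show "sorted_wrt (<) (support \<alpha> (Min C))"
      unfolding m_def[symmetric]
      by (subst sorted_wrt_iff_nth_Suc_transp) (use step in \<open>auto simp: transp_def\<close>)
  qed
qed

end

lemma is_partition_iff:
  "is_partition n \<alpha> \<longleftrightarrow> \<alpha> permutes {1..n} \<and> num_cycles n \<alpha> = card (block_tops n \<alpha>)"
  unfolding is_partition_def using sorted_supports_iff by blast

section \<open>Recursive construction of partitions\<close>

definition partitions :: "nat \<Rightarrow> (nat \<Rightarrow> nat) set" where
  "partitions n = {\<alpha>. is_partition n \<alpha>}"

lemma finite_partitions: "finite (partitions n)"
  using finite_permutations[of "{1..n}"]
  by (rule finite_subset[rotated]) (auto simp: partitions_def is_partition_iff)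

lemma insert_Suc_atLeastAtMost: "insert (Suc n) {1..n} = {1..Suc n}"
  by auto

lemma num_cycles_Suc:
  assumes "\<alpha> permutes {1..n}"
  shows "num_cycles (Suc n) \<alpha> = Suc (num_cycles n \<alpha>)"
proof -
  have "\<alpha> (Suc n) = Suc n" using assms by (simp add: permutes_not_in)
  then have "orbit \<alpha> (Suc n) = {Suc n}" by (simp add: orbit_eq_singleton_iff)
  then have "cycle_sets (Suc n) \<alpha> = insert {Suc n} (cycle_sets n \<alpha>)"
    unfolding cycle_sets_def insert_Suc_atLeastAtMost[symmetric] by simp
  moreover have "{Suc n} \<notin> cycle_sets n \<alpha>"
    using cycle_sets_props(3)[OF assms, of "{Suc n}"] by auto
  ultimately show ?thesis by (simp add: num_cycles_def cycle_sets_def)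
qed

lemma num_cycles_insert:
  assumes "\<alpha> permutes {1..n}" "M \<in> {1..n}"
  shows "num_cycles (Suc n) (\<alpha> \<circ> transpose M (Suc n)) = num_cycles n \<alpha>"
proof -
  let ?\<alpha>' = "\<alpha> \<circ> transpose M (Suc n)"
  \<comment> \<open>The orbit facts about an insertion are used with \<open>\<alpha>\<close> for the
    permutation, \<open>{M}\<close> for \<open>W\<close> and \<open>M\<close> for
    \<open>a\<close>.\<close>
  have M: "{M} \<subseteq> {1..n}" "M \<in> {M}" and n: "Suc n \<notin> {1..n}" using assms(2) by auto
  have p: "?\<alpha>' permutes insert (Suc n) {1..n}"
    using permutes_insert_cycle[OF assms(1) _ M n] by simp
  have "num_cycles (Suc n) ?\<alpha>'
      = Suc (card (orbit ?\<alpha>' ` (insert (Suc n) {1..n} - orbit ?\<alpha>' (Suc n))))"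
    unfolding num_cycles_def cycle_sets_def insert_Suc_atLeastAtMost[symmetric]
    by (rule card_orbits[OF p]) auto
  also have "\<dots> = Suc (card (orbit \<alpha> ` ({1..n} - orbit \<alpha> M)))"
    using new_orbit[OF assms(1) _ M n] other_orbits[OF assms(1) _ M n] by simp
  also have "\<dots> = num_cycles n \<alpha>"
    unfolding num_cycles_def cycle_sets_def using card_orbits[OF assms(1) _ assms(2)] by simp
  finally show ?thesis .
qed

lemma block_tops_Suc:
  assumes "\<alpha> permutes {1..n}"
  shows "block_tops (Suc n) \<alpha> = insert (Suc n) (block_tops n \<alpha>)"
  using permutes_not_in[OF assms, of "Suc n"] by (auto simp: block_tops_def le_Suc_eq)

lemma block_tops_insert:
  assumes "\<alpha> permutes {1..n}" "M \<in> {1..n}"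
  shows "block_tops (Suc n) (\<alpha> \<circ> transpose M (Suc n)) = insert (Suc n) (block_tops n \<alpha> - {M})"
proof -
  have "\<alpha> M \<in> {1..n}" using assms(2) permutes_in_image[OF assms(1), of M] by blast
  moreover have "\<alpha> (Suc n) = Suc n" using assms(1) by (simp add: permutes_not_in)
  ultimately show ?thesis
    using assms(2) by (auto simp: block_tops_def transpose_def le_Suc_eq)
qed

lemma partition_Suc:
  assumes "\<alpha> \<in> partitions n"
  shows "\<alpha> \<in> partitions (Suc n)"
proof -
  have p: "\<alpha> permutes {1..n}" using assms by (simp add: partitions_def is_partition_iff)
  have "Suc n \<notin> block_tops n \<alpha>" by (simp add: block_tops_def)
  then show ?thesis
    using assms num_cycles_Suc[OF p] block_tops_Suc[OF p] permutes_subset[OF p, of "{1..Suc n}"]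
    by (simp add: partitions_def is_partition_iff)
qed

lemma insert_permutes:
  assumes "\<alpha> permutes {1..n}" "M \<in> {1..n}"
  shows "\<alpha> \<circ> transpose M (Suc n) permutes {1..Suc n}"
  using assms by (intro permutes_compose) (auto intro: permutes_subset permutes_swap_id)

text \<open>The insertion keeps the number of cycles. The number of non-ascents stays the same if
  \<open>M\<close> was one and otherwise grows, exceeding the number of cycles.\<close>

lemma partition_insert_iff:
  assumes p: "\<alpha> permutes {1..n}" and M: "M \<in> {1..n}"
  shows "\<alpha> \<circ> transpose M (Suc n) \<in> partitions (Suc n) \<longleftrightarrow> \<alpha> \<in> partitions n \<and> M \<in> block_tops n \<alpha>"
proof -
  have "Suc n \<notin> block_tops n \<alpha>" by (simp add: block_tops_def)
  then have c: "card (block_tops (Suc n) (\<alpha> \<circ> transpose M (Suc n))) = Suc (card (block_tops n \<alpha> - {M}))"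
    unfolding block_tops_insert[OF p M] by simp
  show ?thesis
  proof (cases "M \<in> block_tops n \<alpha>")
    case True
    then have "Suc (card (block_tops n \<alpha> - {M})) = card (block_tops n \<alpha>)"
      by (metis card.remove finite_block_tops)
    then show ?thesis
      using True c p M num_cycles_insert[OF p M] insert_permutes[OF p M]
      by (simp add: partitions_def is_partition_iff)
  next
    case False
    then show ?thesis
      using c num_cycles_insert[OF p M] num_cycles_le[OF p]
      by (simp add: partitions_def is_partition_iff)
  qed
qed

lemma partitions_Suc:
  "partitions (Suc n) = partitions n \<union>
     (\<lambda>(\<alpha>, M). \<alpha> \<circ> transpose M (Suc n)) ` (SIGMA \<alpha>:partitions n. block_tops n \<alpha>)" (is "_ = _ \<union> ?I")
proof (intro equalityI subsetI)
  fix \<alpha>' assume \<alpha>': "\<alpha>' \<in> partitions (Suc n)"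
  then have p': "\<alpha>' permutes {1..Suc n}" by (simp add: partitions_def is_partition_iff)
  show "\<alpha>' \<in> partitions n \<union> ?I"
  proof (cases "\<alpha>' (Suc n) = Suc n")
    case True
    have p: "\<alpha>' permutes {1..n}"
      by (rule permutes_superset[OF p']) (use True in \<open>auto simp: le_Suc_eq\<close>)
    have "Suc n \<notin> block_tops n \<alpha>'" by (simp add: block_tops_def)
    then have "\<alpha>' \<in> partitions n"
      using \<alpha>' p num_cycles_Suc[OF p] block_tops_Suc[OF p]
      by (simp add: partitions_def is_partition_iff)
    then show ?thesis by blast
  next
    case False
    \<comment> \<open>The predecessor of n + 1 on its cycle; the transposition then takes n + 1 out
      of that cycle.\<close>
    define M where "M = inv \<alpha>' (Suc n)"
    define \<alpha> where "\<alpha> = \<alpha>' \<circ> transpose M (Suc n)"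
    have \<alpha>'M: "\<alpha>' M = Suc n" unfolding M_def using permutes_inverses(1)[OF p'] .
    have "M \<in> {1..Suc n}" unfolding M_def using permutes_inv[OF p'] by (subst permutes_in_image) auto
    moreover have "M \<noteq> Suc n" using \<alpha>'M False by auto
    ultimately have M: "M \<in> {1..n}" by auto
    have "\<alpha> permutes {1..Suc n}"
      unfolding \<alpha>_def using M p' by (intro permutes_compose permutes_swap_id) auto
    then have p: "\<alpha> permutes {1..n}"
      by (rule permutes_superset) (auto simp: \<alpha>_def \<alpha>'M le_Suc_eq)
    have eq: "\<alpha>' = \<alpha> \<circ> transpose M (Suc n)" by (simp add: \<alpha>_def comp_assoc)
    with \<alpha>' partition_insert_iff[OF p M] have "\<alpha> \<in> partitions n" "M \<in> block_tops n \<alpha>" by auto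
    then show ?thesis using eq by auto
  qed
next
  fix \<alpha>' assume "\<alpha>' \<in> partitions n \<union> ?I"
  then show "\<alpha>' \<in> partitions (Suc n)"
  proof
    assume "\<alpha>' \<in> ?I"
    then obtain \<alpha> M where *: "\<alpha> \<in> partitions n" "M \<in> block_tops n \<alpha>" "\<alpha>' = \<alpha> \<circ> transpose M (Suc n)"
      by auto
    moreover have "\<alpha> permutes {1..n}" "M \<in> {1..n}"
      using * by (auto simp: partitions_def is_partition_iff block_tops_def)
    ultimately show ?thesis using partition_insert_iff by blast
  qed (rule partition_Suc)
qed

text \<open>Each partition arises once: either n + 1 is fixed, or \<open>M\<close> is its preimage
  and thereby determines \<open>\<alpha>\<close>.\<close>

lemma sum_partitions_Suc:
  "sum \<Phi> (partitions (Suc n)) = (\<Sum>\<alpha>\<in>partitions n. \<Phi> \<alpha>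
     + (\<Sum>M\<in>block_tops n \<alpha>. \<Phi> (\<alpha> \<circ> transpose M (Suc n))))"
proof -
  let ?g = "\<lambda>(\<alpha>, M). \<alpha> \<circ> transpose M (Suc n)"
  let ?D = "SIGMA \<alpha>:partitions n. block_tops n \<alpha>"
  have top: "(\<alpha> \<circ> transpose M (Suc n)) M = Suc n" "\<alpha> permutes {1..n}" "M \<le> n"
    if "(\<alpha>, M) \<in> ?D" for \<alpha> M
    using that by (auto simp: partitions_def is_partition_iff block_tops_def permutes_not_in)
  have "inj_on ?g ?D"
  proof (rule inj_onI, clarify)
    fix \<alpha> \<alpha>' :: "nat \<Rightarrow> nat" and M M'
    assume *: "\<alpha> \<in> partitions n" "M \<in> block_tops n \<alpha>" "\<alpha>' \<in> partitions n" "M' \<in> block_tops n \<alpha>'"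
      and eq: "\<alpha> \<circ> transpose M (Suc n) = \<alpha>' \<circ> transpose M' (Suc n)"
    have "inj (\<alpha> \<circ> transpose M (Suc n))"
      using * permutes_inj[of \<alpha>] by (intro inj_compose) (auto simp: partitions_def is_partition_iff)
    moreover have "(\<alpha> \<circ> transpose M (Suc n)) M = (\<alpha> \<circ> transpose M (Suc n)) M'"
      using top(1)[of \<alpha> M] top(1)[of \<alpha>' M'] * unfolding eq by auto
    ultimately have MM: "M = M'" by (rule injD)
    have "(\<alpha> \<circ> transpose M (Suc n)) \<circ> transpose M (Suc n) = (\<alpha>' \<circ> transpose M (Suc n)) \<circ> transpose M (Suc n)"
      using eq MM by simp
    then show "\<alpha> = \<alpha>' \<and> M = M'" using MM by (simp add: comp_assoc)
  qed
  moreover have "partitions n \<inter> ?g ` ?D = {}"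
  proof -
    have "\<alpha>' M \<noteq> Suc n" if "\<alpha>' \<in> partitions n" "M \<le> n" for \<alpha>' M
      using that permutes_in_image[of \<alpha>' "{1..n}" M] permutes_not_in[of \<alpha>' "{1..n}" M]
      by (cases "M \<in> {1..n}") (auto simp: partitions_def is_partition_iff)
    moreover have "(\<alpha> \<circ> transpose M (Suc n)) M = Suc n" "M \<le> n" if "(\<alpha>, M) \<in> ?D" for \<alpha> M
      using top that by blast+
    ultimately have "?g x \<notin> partitions n" if "x \<in> ?D" for x
      using that by (cases x) (metis case_prod_conv)
    then show ?thesis by blast
  qed
  ultimately have "sum \<Phi> (partitions (Suc n)) = sum \<Phi> (partitions n) + sum (\<Phi> \<circ> ?g) ?D"
    unfolding partitions_Suc
    by (subst sum.union_disjoint) (auto simp: finite_partitions sum.reindex intro!: finite_imageI finite_SigmaI)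
  also have "sum (\<Phi> \<circ> ?g) ?D = (\<Sum>\<alpha>\<in>partitions n. \<Sum>M\<in>block_tops n \<alpha>. \<Phi> (\<alpha> \<circ> transpose M (Suc n)))"
    by (subst sum.Sigma) (auto simp: finite_partitions intro!: sum.cong)
  finally show ?thesis by (simp add: sum.distrib)
qed

section \<open>The Kreweras complement and the state of a partition\<close>

lemma zeta_permutes: "zeta n permutes {1..n}"
  unfolding zeta_def using cycle_permutes[of "[1..<Suc n]"] by (simp add: atLeastLessThanSuc_atLeastAtMost del: upt_Suc)

lemma zeta_Suc:
  assumes "n \<ge> 1"
  shows "zeta (Suc n) = zeta n \<circ> transpose n (Suc n)"
proof
  fix i
  have out: "zeta n (Suc n) = Suc n" using zeta_permutes by (rule permutes_not_in) simp
  consider "i \<in> {1..<n}" | "i = n" | "i = Suc n" | "i \<notin> {1..Suc n}" by fastforce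
  then show "zeta (Suc n) i = (zeta n \<circ> transpose n (Suc n)) i"
  proof cases
    case 4
    then show ?thesis
      using assms permutes_not_in[OF zeta_permutes] by (auto simp: transpose_def)
  qed (use assms out in \<open>auto simp: zeta_apply transpose_def\<close>)
qed

definition kreweras :: "nat \<Rightarrow> (nat \<Rightarrow> nat) \<Rightarrow> nat \<Rightarrow> nat" where
  "kreweras n \<alpha> = inv \<alpha> \<circ> zeta n"

lemma kreweras_permutes: "\<alpha> permutes {1..n} \<Longrightarrow> kreweras n \<alpha> permutes {1..n}"
  unfolding kreweras_def by (intro permutes_compose zeta_permutes permutes_inv)

lemma kreweras_Suc:
  "n \<ge> 1 \<Longrightarrow> kreweras (Suc n) \<alpha> = kreweras n \<alpha> \<circ> transpose n (Suc n)"
  by (simp add: kreweras_def zeta_Suc comp_assoc)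

lemma kreweras_insert:
  assumes "n \<ge> 1" "\<alpha> permutes {1..n}"
  shows "kreweras (Suc n) (\<alpha> \<circ> transpose M (Suc n))
    = transpose M (Suc n) \<circ> (kreweras n \<alpha> \<circ> transpose n (Suc n))"
proof -
  have "inv (\<alpha> \<circ> transpose M (Suc n)) = transpose M (Suc n) \<circ> inv \<alpha>"
    using permutes_bij[OF assms(2)] by (simp add: o_inv_distrib)
  then show ?thesis using assms(1) by (simp add: kreweras_def zeta_Suc comp_assoc)
qed

definition cur :: "nat \<Rightarrow> (nat \<Rightarrow> nat) \<Rightarrow> nat" where
  "cur n \<alpha> = cur_size (kreweras n \<alpha>) (block_tops n \<alpha>) n"

definition others :: "nat \<Rightarrow> (nat \<Rightarrow> nat) \<Rightarrow> nat multiset" where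
  "others n \<alpha> = other_sizes (kreweras n \<alpha>) (block_tops n \<alpha>) {1..n} n"

text \<open>The complement has one cycle through n besides those in \<open>others\<close>, which
  accounts for the + 1 in the definition of the genus.\<close>

definition double_genus :: "nat \<Rightarrow> (nat \<Rightarrow> nat) \<Rightarrow> int" where
  "double_genus n \<alpha> = int n - int (num_cycles n \<alpha>) - int (size (others n \<alpha>))"

lemma has_genus_iff:
  assumes "n \<ge> 1" "\<alpha> permutes {1..n}"
  shows "has_genus n \<alpha> g \<longleftrightarrow> double_genus n \<alpha> = 2 * int g"
proof -
  have "num_cycles n (kreweras n \<alpha>) = Suc (size (others n \<alpha>))"
    using card_orbits[OF kreweras_permutes[OF assms(2)], of n] assms(1)
    by (simp add: num_cycles_def cycle_sets_def others_def other_sizes_def)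
  then show ?thesis by (auto simp: has_genus_def double_genus_def kreweras_def)
qed

context
  fixes n :: nat and \<alpha> :: "nat \<Rightarrow> nat"
  assumes n: "n \<ge> 1" and part: "\<alpha> \<in> partitions n"
begin

lemma permutes_\<alpha>: "\<alpha> permutes {1..n}"
  using part by (simp add: partitions_def is_partition_iff)

lemma top_n: "block_tops n \<alpha> \<subseteq> {1..n}" "n \<in> block_tops n \<alpha>" "Suc n \<notin> {1..n}"
  using n permutes_in_image[OF permutes_\<alpha>, of n] by (auto simp: block_tops_def)

lemmas krew = kreweras_permutes[OF permutes_\<alpha>] finite_atLeastAtMost top_n

lemma new_singleton:
  "num_cycles (Suc n) \<alpha> = Suc (num_cycles n \<alpha>)" "cur (Suc n) \<alpha> = Suc (cur n \<alpha>)"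
  "others (Suc n) \<alpha> = others n \<alpha>"
  using new_block[OF krew] num_cycles_Suc[OF permutes_\<alpha>]
  by (simp_all add: cur_def others_def kreweras_Suc[OF n] block_tops_Suc[OF permutes_\<alpha>] insert_Suc_atLeastAtMost
      del: One_nat_def)

lemma num_cycles_insert_top:
  "M \<in> block_tops n \<alpha> \<Longrightarrow> num_cycles (Suc n) (\<alpha> \<circ> transpose M (Suc n)) = num_cycles n \<alpha>"
  using num_cycles_insert[OF permutes_\<alpha>] top_n(1) by blast

lemma sum_insert:
  fixes H :: "nat \<Rightarrow> nat multiset \<Rightarrow> 'c::comm_semiring_1"
  shows "(\<Sum>M\<in>block_tops n \<alpha>. H (cur (Suc n) (\<alpha> \<circ> transpose M (Suc n)))
                                (others (Suc n) (\<alpha> \<circ> transpose M (Suc n))))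
     = (\<Sum>j\<le>cur n \<alpha>. H j (add_mset (cur n \<alpha> - j) (others n \<alpha>)))
       + (\<Sum>c\<in>#others n \<alpha>. of_nat c * H (cur n \<alpha> + c) (others n \<alpha> - {#c#}))"
  unfolding cur_def[of n] others_def[of n] sum_insert_block[OF krew, symmetric] Let_def
  by (intro sum.cong refl)
    (use top_n(1) in \<open>auto simp: cur_def others_def kreweras_insert[OF n permutes_\<alpha>]
      block_tops_insert[OF permutes_\<alpha>] insert_Suc_atLeastAtMost subset_iff simp del: One_nat_def\<close>)

lemma size_others_insert:
  assumes "M \<in> block_tops n \<alpha>"
  shows "size (others (Suc n) (\<alpha> \<circ> transpose M (Suc n))) \<le> Suc (size (others n \<alpha>))"
  using size_insert_block[OF krew assms] top_n(1) assms
  by (auto simp: others_def kreweras_insert[OF n permutes_\<alpha>] block_tops_insert[OF permutes_\<alpha>] insert_Suc_atLeastAtMost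
      subset_iff simp del: One_nat_def)

end

lemma partitions_1: "partitions 1 = {id}"
proof -
  have "card (block_tops 1 id) = 1"
    by (auto simp: block_tops_def card_1_singleton_iff)
  moreover have "cycle_sets 1 id = {orbit id 1}" by (simp add: cycle_sets_def)
  then have "num_cycles 1 id = 1" by (simp add: num_cycles_def)
  moreover have "\<alpha> permutes {1..1} \<longleftrightarrow> \<alpha> = id" for \<alpha> :: "nat \<Rightarrow> nat"
    by (simp only: atLeastAtMost_singleton permutes_sing)
  ultimately have "\<alpha> \<in> partitions 1 \<longleftrightarrow> \<alpha> = id" for \<alpha>
    unfolding partitions_def is_partition_iff mem_Collect_eq by metis
  then show ?thesis by blast
qed

lemma state_id: "cur 1 id = 0" "others 1 id = {#}" "num_cycles 1 id = 1"
proof -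
  have o: "orbit f 1 = {1}" if "f permutes {1..1}" for f :: "nat \<Rightarrow> nat"
    using that by (simp add: orbit_eq_singleton_iff)
  have "kreweras 1 id permutes {1..1}" by (rule kreweras_permutes) (rule permutes_id)
  from o[OF this] have k: "orbit (kreweras 1 id) 1 = {1}" .
  have "block_tops 1 id = {1}" by (auto simp: block_tops_def)
  then show "cur 1 id = 0" "others 1 id = {#}" "num_cycles 1 id = 1"
    using k by (simp_all add: cur_def cur_size_def others_def other_sizes_def num_cycles_def cycle_sets_def)
qed

text \<open>A new block leaves the value unchanged. Enlarging a block raises n by one, keeps the
  number of blocks, and adds at most one other cycle.\<close>

lemma double_genus_nonneg:
  assumes "n \<ge> 1" "\<alpha> \<in> partitions n"
  shows "double_genus n \<alpha> \<ge> 0"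
  using assms
proof (induction n arbitrary: \<alpha> rule: dec_induct)
  case base
  then have "\<alpha> = id" using partitions_1 by blast
  then show ?case by (simp only: double_genus_def state_id) simp
next
  case (step n)
  from step.prems show ?case unfolding partitions_Suc
  proof
    assume a: "\<alpha> \<in> partitions n"
    then show ?thesis using step.IH[OF a] new_singleton[OF step.hyps(1) a] by (simp add: double_genus_def)
  next
    assume "\<alpha> \<in> (\<lambda>(\<alpha>, M). \<alpha> \<circ> transpose M (Suc n)) ` (SIGMA \<alpha>:partitions n. block_tops n \<alpha>)"
    then obtain \<gamma> M where *: "\<gamma> \<in> partitions n" "M \<in> block_tops n \<gamma>" "\<alpha> = \<gamma> \<circ> transpose M (Suc n)"
      by auto
    then show ?thesis
      using step.IH[OF *(1)] num_cycles_insert_top[OF step.hyps(1) *(1,2)]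
        size_others_insert[OF step.hyps(1) *(1,2)]
      unfolding *(3) double_genus_def by linarith
  qed
qed

section \<open>The generating function\<close>

lemma numerator_identity:
  fixes q m x y :: "'a::comm_ring_1"
  assumes x: "x = (1 - q) * (1 - m)" and xy: "x * y = q * m"
  shows "x^6 * y^2 *
      (x^4 * (8 * y^4 - 4 * y^3 - 15 * y^2 + 10 * y + 1)
       + x^3 * (- 4 * y^3 + 39 * y^2 - 10 * y - 4)
       + x^2 * (- 15 * y^2 - 10 * y + 6)
       + x * (10 * y - 4) + 1) = lcoef (w2_list q m) 0 * m"
proof -
  \<comment> \<open>\<open>y\<close> alone is not given by \<open>q\<close> and \<open>m\<close>, so
    the numerator is first written in \<open>x\<close> and \<open>x * y\<close>; no monomial of the
    bracket has larger degree in \<open>y\<close> than in \<open>x\<close>.\<close>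
  have "x^6 * y^2 *
      (x^4 * (8 * y^4 - 4 * y^3 - 15 * y^2 + 10 * y + 1)
       + x^3 * (- 4 * y^3 + 39 * y^2 - 10 * y - 4)
       + x^2 * (- 15 * y^2 - 10 * y + 6)
       + x * (10 * y - 4) + 1)
    = x^4 * (x * y)^2 * (8 * (x * y)^4 - 4 * x * (x * y)^3 - 15 * x^2 * (x * y)^2
       + 10 * x^3 * (x * y) + x^4 - 4 * (x * y)^3 + 39 * x * (x * y)^2 - 10 * x^2 * (x * y)
       - 4 * x^3 - 15 * (x * y)^2 - 10 * x * (x * y) + 6 * x^2 + 10 * (x * y) - 4 * x + 1)"
  proof -
    obtain E where E: "E = peval2 x y" by simp
    show ?thesis by (simp only: peval2_rules[OF E], rule peval2_eqI[OF E], code_simp)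
  qed
  also have "\<dots> = lcoef (w2_list q m) 0 * m"
  proof -
    obtain E where E: "E = peval2 q m" by simp
    show ?thesis
      unfolding xy unfolding x w2_list_def nth_default_Cons_0
      by (simp only: peval2_rules[OF E], rule peval2_eqI[OF E], code_simp)
  qed
  finally show ?thesis .
qed

context growth_ring
begin

text \<open>Stands for \<open>(q - m) ^ 11\<close> times the generating function of the genus 2
  extensions of \<open>\<alpha>\<close>, with \<open>x\<close> counting the elements beyond n and
  \<open>y\<close> all blocks.\<close>

definition weight :: "'a \<Rightarrow> nat \<Rightarrow> (nat \<Rightarrow> nat) \<Rightarrow> 'a" where
  "weight y n \<alpha> = y ^ num_cycles n \<alpha> * pot (double_genus n \<alpha>) (cur n \<alpha>) (others n \<alpha>)"

lemma weight_step:
  assumes n: "n \<ge> 1" and \<alpha>: "\<alpha> \<in> partitions n" and y: "x * y = q * m"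
  shows "weight y n \<alpha> = (if double_genus n \<alpha> = 4 then (q - m) ^ 11 * y ^ num_cycles n \<alpha> else 0)
    + x * (weight y (Suc n) \<alpha> + (\<Sum>M\<in>block_tops n \<alpha>. weight y (Suc n) (\<alpha> \<circ> transpose M (Suc n))))"
proof -
  define k where "k = num_cycles n \<alpha>"
  define N where "N = others n \<alpha>"
  define b where "b = cur n \<alpha>"
  define d where "d = double_genus n \<alpha>"
  \<comment> \<open>With n + 1 and \<open>k\<close> fixed, the genus is read off from
    \<open>N'\<close>: a split adds a cycle and keeps \<open>d\<close>, a join removes one and gives
    \<open>d + 2\<close>.\<close>
  define H where "H b' N' = y ^ k * pot (int (Suc n) - int k - int (size N')) b' N'" for b' N'
  have dN: "d = int n - int k - int (size N)"
    by (simp add: d_def double_genus_def k_def N_def)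
  have "weight y (Suc n) (\<alpha> \<circ> transpose M (Suc n))
      = H (cur (Suc n) (\<alpha> \<circ> transpose M (Suc n))) (others (Suc n) (\<alpha> \<circ> transpose M (Suc n)))"
    if "M \<in> block_tops n \<alpha>" for M
    unfolding weight_def double_genus_def H_def num_cycles_insert_top[OF n \<alpha> that] k_def ..
  then have "(\<Sum>M\<in>block_tops n \<alpha>. weight y (Suc n) (\<alpha> \<circ> transpose M (Suc n)))
      = (\<Sum>j\<le>b. H j (add_mset (b - j) N)) + (\<Sum>c\<in>#N. of_nat c * H (b + c) (N - {#c#}))"
    using sum_insert[OF n \<alpha>, of H] by (simp add: b_def N_def)
  also have "(\<Sum>j\<le>b. H j (add_mset (b - j) N)) = y ^ k * (\<Sum>j\<le>b. pot d j (add_mset (b - j) N))"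
  proof -
    have "int (Suc n) - int k - int (size (add_mset a N)) = d" for a by (simp add: dN)
    then show ?thesis by (simp only: H_def sum_distrib_left)
  qed
  also have "(\<Sum>c\<in>#N. of_nat c * H (b + c) (N - {#c#}))
      = (\<Sum>c\<in>#N. y ^ k * (of_nat c * pot (d + 2) (b + c) (N - {#c#})))"
  proof (intro arg_cong[where f = sum_mset] image_mset_cong)
    fix c assume c: "c \<in># N"
    then have "size (N - {#c#}) = size N - 1" "size N > 0"
      by (auto simp: size_Diff_singleton nonempty_has_size[symmetric])
    then have "int (Suc n) - int k - int (size (N - {#c#})) = d + 2" by (simp add: dN)
    then show "of_nat c * H (b + c) (N - {#c#}) = y ^ k * (of_nat c * pot (d + 2) (b + c) (N - {#c#}))"
      by (simp only: H_def mult_ac)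
  qed
  finally have 1: "(\<Sum>M\<in>block_tops n \<alpha>. weight y (Suc n) (\<alpha> \<circ> transpose M (Suc n)))
      = y ^ k * ((\<Sum>j\<le>b. pot d j (add_mset (b - j) N))
         + (\<Sum>c\<in>#N. of_nat c * pot (d + 2) (b + c) (N - {#c#})))"
    by (simp only: sum_mset_distrib_left distrib_left)
  \<comment> \<open>The new block brings a further \<open>y\<close>, which turns \<open>x\<close>
    into \<open>x * y = q * m\<close>.\<close>
  have "x * weight y (Suc n) \<alpha> = (x * y) * (y ^ k * pot d (Suc b) N)"
    unfolding weight_def double_genus_def new_singleton[OF n \<alpha>]
    by (simp add: dN b_def N_def k_def mult_ac)
  then have 2: "x * weight y (Suc n) \<alpha> = y ^ k * (q * m * pot d (Suc b) N)"
    unfolding y by (simp only: mult_ac)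
  have 3: "weight y n \<alpha> = y ^ k * pot d b N"
    by (simp add: weight_def k_def b_def N_def d_def)
  have "d \<ge> 0" unfolding d_def by (rule double_genus_nonneg[OF n \<alpha>])
  from pot_eq[OF this, of b N] show ?thesis
    unfolding distrib_left[of x] 1 2 unfolding 3 d_def[symmetric] k_def[symmetric]
    by (simp add: distrib_left mult_ac)
qed

lemma sum_weight_step:
  assumes "n \<ge> 1" "x * y = q * m"
  shows "sum (weight y n) (partitions n)
    = (q - m) ^ 11 * (\<Sum>\<alpha>\<in>{\<alpha>\<in>partitions n. double_genus n \<alpha> = 4}. y ^ num_cycles n \<alpha>)
      + x * sum (weight y (Suc n)) (partitions (Suc n))"
proof -
  have "(\<Sum>\<alpha>\<in>partitions n. if double_genus n \<alpha> = 4 then (q - m) ^ 11 * y ^ num_cycles n \<alpha> else 0)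
      = (q - m) ^ 11 * (\<Sum>\<alpha>\<in>{\<alpha>\<in>partitions n. double_genus n \<alpha> = 4}. y ^ num_cycles n \<alpha>)"
    unfolding sum_distrib_left by (rule sum.inter_filter[symmetric]) (rule finite_partitions)
  then show ?thesis
    unfolding sum_partitions_Suc
    by (simp only: weight_step[OF assms(1) _ assms(2)] sum.distrib sum_distrib_left[symmetric] cong: sum.cong)
qed

lemma sum_weight_1: "sum (weight y 1) (partitions 1) = y * r * lcoef (w2_list q m) 0"
  by (simp add: partitions_1 weight_def state_id double_genus_def pot_def pair_sum_def W2_def
      mult_ac del: One_nat_def)

end

section \<open>Comparison of power series\<close>

lemma fps_shift_step:
  fixes f :: "'a::comm_ring_1 fps"
  shows "fps_shift n f = fps_const (fps_nth f n) + fps_X * fps_shift (Suc n) f"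
  by (rule fps_ext) (simp add: fps_shift_def)

text \<open>By iteration, \<open>E 1\<close> is divisible by every power of \<open>fps_X\<close>.
  This gives uniqueness for the recurrence shared by the weights and the shifts of
  \<open>P\<close>.\<close>

lemma fps_X_divisible_imp_zero:
  fixes E :: "nat \<Rightarrow> 'a::comm_ring_1 fps"
  assumes "\<And>n. n \<ge> 1 \<Longrightarrow> E n = fps_X * E (Suc n)"
  shows "E 1 = 0"
proof (rule fps_ext)
  fix i
  have "fps_nth (E n) i = 0" if "n \<ge> 1" for n
    using that
  proof (induction i arbitrary: n)
    case 0
    then show ?case by (subst assms) auto
  next
    case (Suc i)
    then show ?case by (subst assms) auto
  qed
  then show "fps_nth (E 1) i = fps_nth 0 i" by simp
qed

lemma fps_const_sum: "fps_const (sum f A) = (\<Sum>x\<in>A. fps_const (f x))"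
  by (induction A rule: infinite_finite_induct) (simp_all flip: fps_const_add)

lemma P_nth:
  assumes "n \<ge> 1"
  shows "fps_const (fps_nth P n) = (\<Sum>\<alpha>\<in>{\<alpha>\<in>partitions n. double_genus n \<alpha> = 4}. Y ^ num_cycles n \<alpha>)"
proof -
  let ?G = "{\<alpha>\<in>partitions n. double_genus n \<alpha> = 4}"
  have fin: "finite ?G" using finite_partitions by simp
  have "fps_nth P n = (\<Sum>\<alpha>\<in>?G. fps_X ^ num_cycles n \<alpha>)"
  proof (rule fps_ext)
    fix k
    have "{\<alpha>. is_partition n \<alpha> \<and> has_genus n \<alpha> 2 \<and> num_cycles n \<alpha> = k} = {\<alpha>\<in>?G. num_cycles n \<alpha> = k}"
      using has_genus_iff[OF assms, of _ 2] by (auto simp: partitions_def is_partition_iff)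
    then have "num_genus2_partitions n k = card {\<alpha>\<in>?G. num_cycles n \<alpha> = k}"
      by (simp add: num_genus2_partitions_def)
    moreover have "fps_nth (fps_nth P n) k = of_nat (num_genus2_partitions n k)" if "k \<noteq> 0"
      using assms that by (simp add: P_def)
    moreover have "fps_nth (fps_nth P n) 0 = 0" by (simp add: P_def)
    \<comment> \<open>Since n is positive there is a cycle, in agreement with the coefficient 0 that
      \<open>P\<close> has at k = 0.\<close>
    moreover have "num_cycles n \<alpha> \<noteq> 0" for \<alpha>
      using assms by (simp add: num_cycles_def cycle_sets_def)
    then have "{\<alpha>\<in>?G. num_cycles n \<alpha> = 0} = {}" by blast
    then have "card {\<alpha>\<in>?G. num_cycles n \<alpha> = 0} = 0" by (simp only: card.empty)
    ultimately have "fps_nth (fps_nth P n) k = of_nat (card {\<alpha>\<in>?G. num_cycles n \<alpha> = k})"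
      by (metis of_nat_0)
    also have "\<dots> = (\<Sum>\<alpha>\<in>?G. if num_cycles n \<alpha> = k then 1 else 0)"
      using fin by (simp add: sum.inter_filter[symmetric] Int_def)
    also have "\<dots> = fps_nth (\<Sum>\<alpha>\<in>?G. fps_X ^ num_cycles n \<alpha>) k"
      by (simp add: fps_sum_nth fps_X_power_nth eq_commute)
    finally show "fps_nth (fps_nth P n) k = fps_nth (\<Sum>\<alpha>\<in>?G. fps_X ^ num_cycles n \<alpha>) k" .
  qed
  then show ?thesis by (simp add: fps_const_sum Y_def flip: fps_const_power)
qed

theorem theorem9p3:
  shows "P =
    X^6 * Y^2 *
      (X^4 * (8 * Y^4 - 4 * Y^3 - 15 * Y^2 + 10 * Y + 1)
       + X^3 * (- 4 * Y^3 + 39 * Y^2 - 10 * Y - 4)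
       + X^2 * (- 15 * Y^2 - 10 * Y + 6)
       + X * (10 * Y - 4) + 1)
    / half_power (X^2 - 2 * X^2 * Y - 2 * X + X^2 * Y^2 - 2 * X * Y + 1) 11"
proof -
  let ?num = "X^6 * Y^2 *
      (X^4 * (8 * Y^4 - 4 * Y^3 - 15 * Y^2 + 10 * Y + 1)
       + X^3 * (- 4 * Y^3 + 39 * Y^2 - 10 * Y - 4)
       + X^2 * (- 15 * Y^2 - 10 * Y + 6)
       + X * (10 * Y - 4) + 1)"
  define D :: bifps where "D = X^2 - 2 * X^2 * Y - 2 * X + X^2 * Y^2 - 2 * X * Y + 1"
  have X0: "fps_nth X 0 = 0" by (simp add: X_def)
  have D00: "fps_nth (fps_nth D 0) 0 = 1"
    by (simp add: D_def X0 power2_eq_square)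
  define s where "s = half_power D 1"
  have s2: "s ^ 2 = D" and s00: "fps_nth (fps_nth s 0) 0 = 1"
    using half_power[OF D00, of 1] by (simp_all add: s_def)
  \<comment> \<open>The square of \<open>s ^ 11\<close> is \<open>D ^ 11\<close> and its constant
    term is 1, so uniqueness applies.\<close>
  have "half_power D 11 = s ^ 11"
    unfolding half_power_def
    by (rule the1_equality[OF half_power_ex1[OF D00]])
      (simp add: s2[symmetric] s00 fps_nth_power_0 power_mult[symmetric])
  note hp = this
  define c :: bifps where "c = fps_const (fps_const (1 / 2))"
  have c2: "2 * c = 1"
    by (simp add: c_def fps_numeral_fps_const)
  \<comment> \<open>\<open>q\<close> and \<open>m\<close> are the roots of t^2 - (1 - X + X Y) t + X
    Y, whose discriminant is \<open>D\<close>.\<close>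
  define q where "q = c * (1 - X + X * Y + s)"
  define m where "m = c * (1 - X + X * Y - s)"
  have "2 * c * s = s" "2 * c * (1 - X + X * Y) = 1 - X + X * Y" using c2 by simp_all
  then have qm_diff: "q - m = s" and qm_sum: "q + m = 1 - X + X * Y"
    unfolding q_def m_def by (simp_all add: algebra_simps)
  have "q * m = c * c * ((1 - X + X * Y)^2 - s^2)"
    unfolding q_def m_def by (simp add: algebra_simps power2_eq_square)
  also have "\<dots> = (2 * c) * (2 * c) * (X * Y)"
    unfolding s2 D_def by (simp add: algebra_simps power2_eq_square)
  finally have qm: "X * Y = q * m" using c2 by simp
  have x: "X = (1 - q) * (1 - m)"
  proof -
    have "(1 - q) * (1 - m) = 1 - (q + m) + q * m" by (simp add: algebra_simps)
    then show ?thesis unfolding qm_sum qm[symmetric] by simp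
  qed
  have "fps_nth (fps_nth q 0) 0 = 1" "fps_nth (fps_nth (1 - m) 0) 0 = 1"
    by (simp_all add: q_def m_def c_def X0 s00)
  then have "(1 / q) * q = 1" "(1 / (1 - m)) * (1 - m) = 1"
    by (auto intro: bifps_divide_mult)
  then interpret growth_ring q m "1 / q" "1 / (1 - m)" by unfold_locales
  \<comment> \<open>Both terms satisfy A(n) = s^11 p(n) + X A(n+1), where p(n) is the coefficient of
    X^n in \<open>P\<close>.\<close>
  define E where "E n = sum (weight Y n) (partitions n) - s ^ 11 * fps_shift n P" for n
  have fX: "(1 - q) * (1 - m) = fps_X" using x by (simp only: X_def)
  have "E n = fps_X * E (Suc n)" if "n \<ge> 1" for n
    unfolding E_def sum_weight_step[OF that qm[unfolded x]] fps_shift_step[of n] P_nth[OF that] qm_diff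
    by (simp only: fX) (simp add: algebra_simps)
  then have "E 1 = 0" by (rule fps_X_divisible_imp_zero)
  \<comment> \<open>The extra factor \<open>X\<close> combines with the \<open>Y\<close> of the
    single block to X Y = q m, which then absorbs \<open>1 / q\<close>.\<close>
  then have "s ^ 11 * (X * fps_shift 1 P) = X * (Y * (1 / q) * lcoef (w2_list q m) 0)"
    unfolding E_def sum_weight_1 by (simp add: mult_ac)
  also have "\<dots> = (X * Y) * (1 / q) * lcoef (w2_list q m) 0" by (simp only: mult_ac)
  also have "\<dots> = ((1 / q) * q) * (lcoef (w2_list q m) 0 * m)" unfolding qm by (simp only: mult_ac)
  also have "\<dots> = ?num" unfolding numerator_identity[OF x qm] r_q by simp
  also have "X * fps_shift 1 P = P"
  proof -
    have "fps_nth P 0 = 0" by (simp add: P_def fps_eq_iff)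
    then show ?thesis using fps_shift_step[of 0 P] by (simp add: X_def)
  qed
  finally have "P * s ^ 11 = ?num" by (simp only: mult.commute)
  moreover have "?num / s ^ 11 * s ^ 11 = ?num"
    by (rule bifps_divide_mult) (simp add: fps_nth_power_0 s00)
  moreover have "s ^ 11 \<noteq> 0" using s00 by auto
  ultimately have "P = ?num / s ^ 11" by (metis mult_right_cancel)
  then show ?thesis unfolding hp[symmetric] D_def .
qed

end
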